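(* Consider the coupled equality-constrained problem $\mathcal P_{\mathrm c}$ of the context, and assume: (1) the graph $\mathcal G$ is undirected and connected; (2) each $f_i:\mathbb R^d\to\mathbb R$ and each $\mathbf h_i^{\mathrm c}:\mathbb R^d\to\mathbb R^{q}$ is twice continuously differentiable, and $\nabla^2 f_i$ and the Jacobian $\mathbf J_i^{\mathrm c}=\partial\mathbf h_i^{\mathrm c}/\partial\mathbf x_i$ are locally Lipschitz continuous; (3) there exist $\mathbf s_{\mathrm c}^{\ast}\in\Omega_{\mathrm c}$, an open neighborhood $\mathcal U_{\mathrm c}\subset\mathbb R^d$ of $\mathbf s_{\mathrm c}^{\ast}$ and $\rho_{\mathrm c}>0$ such that $\mathbf s_{\mathrm c}^{\ast}$ is a local minimizer of $F$ on $\Omega_{\mathrm c}\cap\mathcal U_{\mathrm c}$ and $F(\mathbf s)\ge F(\mathbf s_{\mathrm c}^{\ast})+\frac{\rho_{\mathrm c}}{2}\|\mathbf s-\mathbf s_{\mathrm c}^{\ast}\|^2$ for all $\mathbf s\in\Omega_{\mathrm c}\cap\mathcal U_{\mathrm c}$; (4) for every $\mathbf x=\operatorname{col}(\mathbf x_1,\ldots,\mathbf x_N)\in\mathcal X_{\mathrm c}\cap(\mathbf 1_N\otimes\mathcal U_{\mathrm c})$, $\operatorname{rank}\sum_{i=1}^N\mathbf J_i^{\mathrm c}(\mathbf x_i)=q$. Let $\mathbf x_{\mathrm c}^{\ast}:=\mathbf 1_N\otimes\mathbf s_{\mathrm c}^{\ast}$, let $\alpha_{\mathrm{SP}}\in(0,\min\{\rho_{\mathrm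 c}/N,\alpha_G\})$, let $\tau^\ast>0$ be a threshold for $\alpha_{\mathrm{SP}}$ for the continuous-time SP realization (as defined in the context), and fix any $\tau\in(0,\tau^\ast)$. Then, for any $\alpha_{\mathrm E}\in(0,\alpha_{\mathrm{SP}})$, there exists $T_{\mathrm c}^\ast>0$ such that, for every $T\in(0,T_{\mathrm c}^\ast)$, the algorithm FS-NCE $$\begin{aligned}\mathbf v^k&=K_{pc}\mathbf L\mathbf x^k+\mathbf z_c^k,\qquad \bm\mu^k=K_{ph}\big(\mathbf h^{\mathrm c}(\mathbf x^k)+\mathbf L_q\bm\zeta^k\big)+\mathbf z_h^k,\\ \mathbf x^{k+1}&=\mathbf x^k-T\big(\nabla f(\mathbf x^k)+\mathbf v^k+\tilde{\mathbf J}^{\mathrm c}(\mathbf x^k)^\top\bm\mu^k\big),\qquad \bm\zeta^{k+1}=\bm\zeta^k-T\mathbf L_q\bm\mu^k,\\ \mathbf z_c^{k+1}&=\mathbf z_c^k-TK_{pc}\mathbf G_g(\mathbf L\mathbf x^k),\qquad \mathbf z_h^{k+1}=\mathbf z_h^k-TK_{ph}\mathbf G_h\big(\mathbf h^{\mathrm c}(\mathbf x^k)+\mathbf L_q\bm\zeta^k\big),\end{aligned}$$ with $\mathbf z^k=\operatorname{col}(\mathbf z_c^k,\mathbf z_h^k)$, $\bm\zeta^0\in\operatorname{Im}\mathbf L_q$ and $\mathbf z_c^0\in\operatorname{Im}\mathbf L$, admits a locally unique equilibrium $(\mathbf x_{\mathrm c}^{\ast},\bm\zeta^\ast,\mathbf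 z^\ast)$, which is locally exponentially stable. Specifically, there exist constants $C_{\mathrm E}>0$ and $\delta_{\mathrm E}>0$ such that, if $\|\mathbf x^0-\mathbf x_{\mathrm c}^{\ast}\|+\|\bm\zeta^0-\bm\zeta^\ast\|+\|\mathbf z^0-\mathbf z^\ast\|<\delta_{\mathrm E}$, then for all $k=0,1,2,\ldots$ $$\begin{aligned}&\|\mathbf x^k-\mathbf x_{\mathrm c}^{\ast}\|+\|\bm\zeta^k-\bm\zeta^\ast\|+\|\mathbf z^k-\mathbf z^\ast\|+\|\mathbf L\mathbf x^k\|+\|\mathbf h^{\mathrm c}(\mathbf x^k)+\mathbf L_q\bm\zeta^k\|\\&\quad\le C_{\mathrm E}e^{-\alpha_{\mathrm E}kT}\big(\|\mathbf x^0-\mathbf x_{\mathrm c}^{\ast}\|+\|\bm\zeta^0-\bm\zeta^\ast\|+\|\mathbf z^0-\mathbf z^\ast\|\big).\end{aligned}$$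
   Context: Network: agents $\mathcal V=\{1,\ldots,N\}$ communicate over an undirected weighted graph $\mathcal G$ with symmetric adjacency matrix $[a_{ij}]$, $a_{ij}>0$ if $i,j$ can exchange information and $a_{ij}=0$ otherwise. The Laplacian $\mathbf L_{\mathcal G}$ has entries $[\mathbf L_{\mathcal G}]_{ij}=-a_{ij}$ ($i\ne j$) and $[\mathbf L_{\mathcal G}]_{ii}=\sum_j a_{ij}$. Put $\mathbf L:=\mathbf L_{\mathcal G}\otimes\mathbf I_d$, $\mathbf L_q:=\mathbf L_{\mathcal G}\otimes\mathbf I_q$. $\operatorname{col}$ denotes vertical concatenation, $\operatorname{blkdiag}$ the block-diagonal matrix, $\mathbf 1_N$ the all-ones vector, and $\mathbf 1_N\otimes\mathcal U:=\{\mathbf 1_N\otimes\mathbf s:\mathbf s\in\mathcal U\}$. Norms are Euclidean. Problem $\mathcal P_{\mathrm c}$: minimize $\sum_{i=1}^N f_i(\mathbf x_i)$ over $\mathbf x_1,\ldots,\mathbf x_N\in\mathbb R^d$ subject to $\mathbf x_i=\mathbf x_j$ for all $i,j$ and $\sum_{i=1}^N\mathbf h_i^{\mathrm c}(\mathbf x_i)=\mathbf 0$, where $f_i:\mathbb R^d\to\mathbb R$, $\mathbf h_i^{\mathrm c}:\mathbb R^d\to\mathbb R^q$. Put $F(\mathbf s):=\sum_i f_i(\mathbf s)$, $\Omega_{\mathrm c}:=\{\mathbf s\in\mathbb R^d:\sum_i\mathbf h_i^{\mathrm c}(\mathbf s)=\mathbf 0\}$, $\mathcal X_{\mathrm c}:=\{\mathbf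 1_N\otimes\mathbf s:\mathbf s\in\Omega_{\mathrm c}\}$. For $\mathbf x=\operatorname{col}(\mathbf x_1,\ldots,\mathbf x_N)\in\mathbb R^{Nd}$: $f(\mathbf x):=\sum_i f_i(\mathbf x_i)$, $\mathbf h^{\mathrm c}(\mathbf x):=\operatorname{col}(\mathbf h_1^{\mathrm c}(\mathbf x_1),\ldots,\mathbf h_N^{\mathrm c}(\mathbf x_N))\in\mathbb R^{Nq}$, $\tilde{\mathbf J}^{\mathrm c}(\mathbf x):=\operatorname{blkdiag}(\mathbf J_1^{\mathrm c}(\mathbf x_1),\ldots,\mathbf J_N^{\mathrm c}(\mathbf x_N))$. The variable $\bm\zeta\in\mathbb R^{Nq}$ is auxiliary. Assigned output vector field: $\mathbf G_{\mathrm c}:\operatorname{Im}\mathbf L\times\mathbb R^{Nq}\to\operatorname{Im}\mathbf L\times\mathbb R^{Nq}$ is a fixed continuously differentiable map with $\mathbf G_{\mathrm c}(\mathbf 0)=\mathbf 0$ such that the origin of $\dot{\mathbf y}=\mathbf G_{\mathrm c}(\mathbf y)$ is globally exponentially stable with convergence rate $\alpha_G>0$ (i.e. $\|\mathbf y(t)\|\le c\,e^{-\alpha_G t}\|\mathbf y(0)\|$ for some constant $c$ and all solutions). It is block-separable: $\mathbf G_{\mathrm c}(\operatorname{col}(\mathbf y_g,\mathbf y_h))=\operatorname{col}(\mathbf G_g(\mathbf y_g),\mathbf G_h(\mathbf y_h))$ with $\mathbf G_g(\mathbf y_g)=\operatorname{col}(\mathbf G_{g,1}(\mathbf y_{g,1}),\ldots,\mathbf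 G_{g,N}(\mathbf y_{g,N}))$ and $\mathbf G_h(\mathbf y_h)=\operatorname{col}(\mathbf G_{h,1}(\mathbf y_{h,1}),\ldots,\mathbf G_{h,N}(\mathbf y_{h,N}))$. Gains: $K_{0c},K_{0h}>0$ are fixed constants, $\tau>0$ is the singular-perturbation parameter, $K_{pc}:=K_{0c}/\tau$, $K_{ph}:=K_{0h}/\tau$; $T>0$ is the sampling period. Continuous-time SP realization: $\dot{\mathbf x}=-\nabla f(\mathbf x)-\mathbf v-\tilde{\mathbf J}^{\mathrm c}(\mathbf x)^{\top}\bm\mu$, $\dot{\bm\zeta}=-\mathbf L_q\bm\mu$, $\mathbf v=K_{pc}\mathbf L\mathbf x+\mathbf z_c$, $\bm\mu=K_{ph}(\mathbf h^{\mathrm c}(\mathbf x)+\mathbf L_q\bm\zeta)+\mathbf z_h$, $\dot{\mathbf z}_c=-K_{pc}\mathbf G_g(\mathbf L\mathbf x)$, $\dot{\mathbf z}_h=-K_{ph}\mathbf G_h(\mathbf h^{\mathrm c}(\mathbf x)+\mathbf L_q\bm\zeta)$, $\mathbf z=\operatorname{col}(\mathbf z_c,\mathbf z_h)$, $\mathbf z_c(0)\in\operatorname{Im}\mathbf L$, $\bm\zeta(0)\in\operatorname{Im}\mathbf L_q$. Threshold: $\tau^\ast>0$ is a threshold for $\alpha_{\mathrm{SP}}$ if for every $\tau\in(0,\tau^\ast)$ this realization has a locally unique equilibrium $(\mathbf x_{\mathrm c}^{\ast},\bm\zeta^\ast,\mathbf z^\ast)$ and there are $C_{\mathrm{SP}},\delta_{\mathrm{SP}}>0$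 such that $\|\mathbf x(0)-\mathbf x_{\mathrm c}^{\ast}\|+\|\mathbf h^{\mathrm c}(\mathbf x(0))+\mathbf L_q\bm\zeta(0)\|+\|\mathbf z(0)-\mathbf z^\ast\|<\delta_{\mathrm{SP}}$ implies $\|\mathbf x(t)-\mathbf x_{\mathrm c}^{\ast}\|+\|\bm\zeta(t)-\bm\zeta^\ast\|+\|\mathbf z(t)-\mathbf z^\ast\|+\|\mathbf L\mathbf x(t)\|+\|\mathbf h^{\mathrm c}(\mathbf x(t))+\mathbf L_q\bm\zeta(t)\|\le C_{\mathrm{SP}}e^{-\alpha_{\mathrm{SP}}t}(\|\mathbf x(0)-\mathbf x_{\mathrm c}^{\ast}\|+\|\bm\zeta(0)-\bm\zeta^\ast\|+\|\mathbf z(0)-\mathbf z^\ast\|)$ for all $t\ge0$. (Under hypotheses (1)–(4) such a threshold exists for every $\alpha_{\mathrm{SP}}\in(0,\min\{\rho_{\mathrm c}/N,\alpha_G\})$.) The admissible state space, for both the continuous and discrete dynamics, is $\{(\mathbf x,\bm\zeta,\mathbf z_c,\mathbf z_h):\bm\zeta\in\operatorname{Im}\mathbf L_q,\ \mathbf z_c\in\operatorname{Im}\mathbf L\}$, which is invariant; "locally unique equilibrium" means the only equilibrium (fixed point) in some neighborhood of it in this space. *)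

theory Defs
  imports "HOL-Analysis.Analysis"
begin

text \<open>
  A stacked vector \<open>col(x\<^sub>1, \<dots>, x\<^sub>N)\<close> of \<open>N\<close> blocks in \<open>\<real>\<^sup>m\<close> has type \<^typ>\<open>real^'m^'n\<close>, with
  \<open>N = CARD('n)\<close> and \<open>m = CARD('m)\<close>; \<open>col(u, w)\<close> of two stacked vectors is the pair \<open>(u, w)\<close>.
  The library norms on these types are the Euclidean norms of the concatenated vectors.
\<close>

section \<open>Graph and Laplacian\<close>

definition undirected_graph :: "real^'n^'n \<Rightarrow> bool" where
  "undirected_graph A \<longleftrightarrow> (\<forall>i j. A $ i $ j \<ge> 0) \<and> transpose A = A"

definition connected_graph :: "real^'n^'n \<Rightarrow> bool" where
  "connected_graph A \<longleftrightarrow> (\<forall>i j. (i, j) \<in> {(k, l). A $ k $ l > 0}\<^sup>*)"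

definition laplacian :: "real^'n^'n \<Rightarrow> real^'n^'n" where
  "laplacian A = (\<chi> i j. if i = j then (\<Sum>k\<in>UNIV. A $ i $ k) else - (A $ i $ j))"

text \<open>The action of \<open>M \<otimes> I\<^sub>m\<close> on stacked vectors: its \<open>(i, j)\<close> block is \<open>M\<^sub>i\<^sub>j I\<^sub>m\<close>.\<close>

definition kron_id :: "real^'n^'n \<Rightarrow> real^'m^'n \<Rightarrow> real^'m^'n" where
  "kron_id M x = (\<chi> i. \<Sum>j\<in>UNIV. M $ i $ j *\<^sub>R x $ j)"

text \<open>Both \<open>\<^bold>L = L\<^sub>G \<otimes> I\<^sub>d\<close> and \<open>\<^bold>L\<^sub>q = L\<^sub>G \<otimes> I\<^sub>q\<close>, depending on the block type.\<close>

abbreviation lap :: "real^'n^'n \<Rightarrow> real^'m^'n \<Rightarrow> real^'m^'n" where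
  "lap A \<equiv> kron_id (laplacian A)"

section \<open>Stacked maps\<close>

text \<open>\<open>\<^bold>1\<^sub>N \<otimes> s\<close>\<close>

definition ones_kron :: "real^'m \<Rightarrow> real^'m^'n" where
  "ones_kron s = (\<chi> i. s)"

definition col_map :: "('n \<Rightarrow> real^'k \<Rightarrow> real^'m) \<Rightarrow> real^'k^'n \<Rightarrow> real^'m^'n" where
  "col_map g x = (\<chi> i. g i (x $ i))"

text \<open>The product \<open>blkdiag(B\<^sub>1, \<dots>, B\<^sub>N)\<^sup>T y\<close>.\<close>

definition blkdiag_transpose_mult :: "('n \<Rightarrow> real^'k^'m) \<Rightarrow> real^'m^'n \<Rightarrow> real^'k^'n" where
  "blkdiag_transpose_mult B y = (\<chi> i. transpose (B i) *v y $ i)"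

definition block_separable ::
  "((real^'d^'n) \<times> (real^'q^'n)) set \<Rightarrow>
   ((real^'d^'n) \<times> (real^'q^'n) \<Rightarrow> (real^'d^'n) \<times> (real^'q^'n)) \<Rightarrow>
   ('n \<Rightarrow> real^'d \<Rightarrow> real^'d) \<Rightarrow> ('n \<Rightarrow> real^'q \<Rightarrow> real^'q) \<Rightarrow> bool" where
  "block_separable S G Gg Gh \<longleftrightarrow>
     (\<forall>yg yh. (yg, yh) \<in> S \<longrightarrow> G (yg, yh) = (col_map Gg yg, col_map Gh yh))"

section \<open>Smoothness\<close>

definition grad :: "('a::real_inner \<Rightarrow> real) \<Rightarrow> 'a \<Rightarrow> 'a" where
  "grad f x = (THE D. GDERIV f x :> D)"

definition hessian :: "(real^'d \<Rightarrow> real) \<Rightarrow> real^'d \<Rightarrow> real^'d^'d" where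
  "hessian f x = jacobian (grad f) (at x)"

text \<open>
  For a linear subspace \<open>S\<close>, this is continuous differentiability of the restriction of \<open>g\<close> to the
  normed space \<open>S\<close>; derivatives on \<open>S\<close> are extended to the whole space, e.g. by composing
  with the orthogonal projection.
\<close>

definition C1_on :: "'a set \<Rightarrow> ('a::real_normed_vector \<Rightarrow> 'b::real_normed_vector) \<Rightarrow> bool" where
  "C1_on S g \<longleftrightarrow> (\<exists>g' :: 'a \<Rightarrow> 'a \<Rightarrow>\<^sub>L 'b.
     (\<forall>x\<in>S. (g has_derivative blinfun_apply (g' x)) (at x within S)) \<and> continuous_on S g')"

definition C2 :: "('a::real_normed_vector \<Rightarrow> 'b::real_normed_vector) \<Rightarrow> bool" where
  "C2 g \<longleftrightarrow> (\<exists>g' :: 'a \<Rightarrow> 'a \<Rightarrow>\<^sub>L 'b.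
     (\<forall>x. (g has_derivative blinfun_apply (g' x)) (at x)) \<and> C1_on UNIV g')"

text \<open>The library notion is for time-dependent maps; here the time dependence is trivial.\<close>

definition locally_lipschitz :: "('a::metric_space \<Rightarrow> 'b::metric_space) \<Rightarrow> bool" where
  "locally_lipschitz g \<longleftrightarrow> local_lipschitz (UNIV :: real set) UNIV (\<lambda>_. g)"

section \<open>Dynamics\<close>

definition solution :: "('a::real_normed_vector \<Rightarrow> 'a) \<Rightarrow> (real \<Rightarrow> 'a) \<Rightarrow> bool" where
  "solution V y \<longleftrightarrow> (\<forall>t\<ge>0. (y has_vector_derivative V (y t)) (at t within {0..}))"

text \<open>
  Global exponential stability of the origin of \<open>y' = G(y)\<close> on the state space \<open>S\<close>. Since the decay
  bound only concerns solutions on \<open>[0, \<infinity>)\<close>, their existence (forward completeness) is part of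
  the notion; otherwise it would hold vacuously under finite escape times.
\<close>

definition globally_exp_stable ::
  "'a::real_normed_vector set \<Rightarrow> ('a \<Rightarrow> 'a) \<Rightarrow> real \<Rightarrow> bool" where
  "globally_exp_stable S G \<alpha> \<longleftrightarrow>
     (\<forall>y0\<in>S. \<exists>y. y 0 = y0 \<and> (\<forall>t\<ge>0. y t \<in> S) \<and> solution G y) \<and>
     (\<exists>c. \<forall>y. (\<forall>t\<ge>0. y t \<in> S) \<and> solution G y \<longrightarrow>
        (\<forall>t\<ge>0. norm (y t) \<le> c * exp (- \<alpha> * t) * norm (y 0)))"

definition locally_unique :: "'a::topological_space set \<Rightarrow> ('a \<Rightarrow> bool) \<Rightarrow> 'a \<Rightarrow> bool" where
  "locally_unique S E s \<longleftrightarrow> s \<in> S \<and> E s \<and>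
     (\<exists>W. open W \<and> s \<in> W \<and> (\<forall>s'\<in>W \<inter> S. E s' \<longrightarrow> s' = s))"

text \<open>States \<open>(x, \<zeta>, z)\<close> with \<open>z = col(z\<^sub>c, z\<^sub>h)\<close>, i.e. 4-tuples \<open>(x, \<zeta>, z\<^sub>c, z\<^sub>h)\<close>.\<close>

type_synonym ('n, 'd, 'q) state =
  "(real^'d^'n) \<times> (real^'q^'n) \<times> (real^'d^'n) \<times> (real^'q^'n)"

definition admissible :: "real^'n^'n \<Rightarrow> ('n::finite, 'd::finite, 'q::finite) state set" where
  "admissible A = {(x, \<zeta>, zc, zh). \<zeta> \<in> range (lap A) \<and> zc \<in> range (lap A)}"

text \<open>Right-hand side of the continuous-time realization.\<close>

definition sp_field ::
  "real^'n^'n \<Rightarrow> ('n \<Rightarrow> real^'d \<Rightarrow> real) \<Rightarrow> ('n \<Rightarrow> real^'d \<Rightarrow> real^'q) \<Rightarrow>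
   ('n \<Rightarrow> real^'d \<Rightarrow> real^'d) \<Rightarrow> ('n \<Rightarrow> real^'q \<Rightarrow> real^'q) \<Rightarrow> real \<Rightarrow> real \<Rightarrow>
   ('n::finite, 'd::finite, 'q::finite) state \<Rightarrow> ('n, 'd, 'q) state" where
  "sp_field A f h Gg Gh Kpc Kph = (\<lambda>(x, \<zeta>, zc, zh).
     let v = Kpc *\<^sub>R lap A x + zc;
         \<mu> = Kph *\<^sub>R (col_map h x + lap A \<zeta>) + zh
     in (- grad (\<lambda>x. \<Sum>i\<in>UNIV. f i (x $ i)) x - v
           - blkdiag_transpose_mult (\<lambda>i. jacobian (h i) (at (x $ i))) \<mu>,
         - lap A \<mu>,
         - (Kpc *\<^sub>R col_map Gg (lap A x)),
         - (Kph *\<^sub>R col_map Gh (col_map h x + lap A \<zeta>))))"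

text \<open>One iteration of FS-NCE with sampling period \<open>T\<close>.\<close>

definition fs_nce_step ::
  "real^'n^'n \<Rightarrow> ('n \<Rightarrow> real^'d \<Rightarrow> real) \<Rightarrow> ('n \<Rightarrow> real^'d \<Rightarrow> real^'q) \<Rightarrow>
   ('n \<Rightarrow> real^'d \<Rightarrow> real^'d) \<Rightarrow> ('n \<Rightarrow> real^'q \<Rightarrow> real^'q) \<Rightarrow> real \<Rightarrow> real \<Rightarrow> real \<Rightarrow>
   ('n::finite, 'd::finite, 'q::finite) state \<Rightarrow> ('n, 'd, 'q) state" where
  "fs_nce_step A f h Gg Gh Kpc Kph T = (\<lambda>(x, \<zeta>, zc, zh).
     let v = Kpc *\<^sub>R lap A x + zc;
         \<mu> = Kph *\<^sub>R (col_map h x + lap A \<zeta>) + zh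
     in (x - T *\<^sub>R (grad (\<lambda>x. \<Sum>i\<in>UNIV. f i (x $ i)) x + v
           + blkdiag_transpose_mult (\<lambda>i. jacobian (h i) (at (x $ i))) \<mu>),
         \<zeta> - T *\<^sub>R lap A \<mu>,
         zc - (T * Kpc) *\<^sub>R col_map Gg (lap A x),
         zh - (T * Kph) *\<^sub>R col_map Gh (col_map h x + lap A \<zeta>)))"

text \<open>
  \<open>\<tau>s\<close> is a threshold for the rate \<open>\<alpha>\<close>. The decay estimate ``for all \<open>t \<ge> 0\<close>'' includes that solutions
  starting close to the equilibrium exist on \<open>[0, \<infinity>)\<close>.
\<close>

definition sp_threshold ::
  "real^'n^'n \<Rightarrow> ('n \<Rightarrow> real^'d \<Rightarrow> real) \<Rightarrow> ('n \<Rightarrow> real^'d \<Rightarrow> real^'q) \<Rightarrow>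
   ('n \<Rightarrow> real^'d \<Rightarrow> real^'d) \<Rightarrow> ('n \<Rightarrow> real^'q \<Rightarrow> real^'q) \<Rightarrow> real \<Rightarrow> real \<Rightarrow>
   real^'d^'n \<Rightarrow> real \<Rightarrow> real \<Rightarrow> bool" where
  "sp_threshold A f h Gg Gh K0c K0h xs \<alpha> \<tau>s \<longleftrightarrow> \<tau>s > 0 \<and>
     (\<forall>\<tau>. 0 < \<tau> \<and> \<tau> < \<tau>s \<longrightarrow>
       (let V = sp_field A f h Gg Gh (K0c / \<tau>) (K0h / \<tau>) in
        \<exists>\<zeta>s zs. locally_unique (admissible A) (\<lambda>s. V s = 0) (xs, \<zeta>s, zs) \<and>
          (\<exists>C>0. \<exists>\<delta>>0. \<forall>x0 \<zeta>0 z0.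
             (x0, \<zeta>0, z0) \<in> admissible A \<and>
             norm (x0 - xs) + norm (col_map h x0 + lap A \<zeta>0) + norm (z0 - zs) < \<delta> \<longrightarrow>
             (\<exists>y. y 0 = (x0, \<zeta>0, z0) \<and> solution V y) \<and>
             (\<forall>x \<zeta> z. x 0 = x0 \<and> \<zeta> 0 = \<zeta>0 \<and> z 0 = z0 \<and> solution V (\<lambda>t. (x t, \<zeta> t, z t)) \<longrightarrow>
               (\<forall>t\<ge>0. norm (x t - xs) + norm (\<zeta> t - \<zeta>s) + norm (z t - zs)
                        + norm (lap A (x t)) + norm (col_map h (x t) + lap A (\<zeta> t))
                      \<le> C * exp (- \<alpha> * t)
                        * (norm (x0 - xs) + norm (\<zeta>0 - \<zeta>s) + norm (z0 - zs)))))))"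

section \<open>The coupled problem\<close>

definition objective :: "('n::finite \<Rightarrow> real^'d \<Rightarrow> real) \<Rightarrow> real^'d \<Rightarrow> real" where
  "objective f s = (\<Sum>i\<in>UNIV. f i s)"

definition feasible :: "('n::finite \<Rightarrow> real^'d \<Rightarrow> real^'q) \<Rightarrow> (real^'d) set" where
  "feasible h = {s. (\<Sum>i\<in>UNIV. h i s) = 0}"

definition local_minimizer_on ::
  "('a::metric_space \<Rightarrow> real) \<Rightarrow> 'a set \<Rightarrow> 'a \<Rightarrow> bool" where
  "local_minimizer_on F S s \<longleftrightarrow> s \<in> S \<and> (\<exists>e>0. \<forall>s'\<in>S \<inter> ball s e. F s \<le> F s')"

end

theory Submission
  imports Defs
begin

text \<open>
  One step of FS-NCE is an explicit Euler step of length \<open>T\<close> for the continuous-time realization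
  (\<open>fs_nce_step_eq_euler\<close>). Hence both have the same equilibria, and a locally unique equilibrium
  of the one is a locally unique equilibrium of the other. What remains is to transfer the decay
  estimate from the flow to its Euler scheme, with a slightly smaller rate.

  This transfer (\<open>euler_preserves_local_exp_stability\<close>) needs no spectral analysis of a linearization:
  it compares trajectories over one finite time block. Let a run start at distance \<open>r\<close> from the
  equilibrium \<open>p\<close>. Since the field \<open>V\<close> is Lipschitz near \<open>p\<close> and \<open>V p = 0\<close>, its values, and therefore the
  local truncation errors, are proportional to \<open>r\<close>; on a bounded time horizon the Euler scheme
  thus deviates from the flow by at most \<open>O(T) r\<close> (\<open>euler_global_error\<close>). For a long horizon the flow alone
  contracts more than required, because \<open>\<alpha>E < \<alpha>SP\<close>, and for small \<open>T\<close> the deviation fits into the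
  margin. So the scheme contracts over the block by the desired factor, and the
  argument repeats from the new, closer starting point (\<open>geometric_decay_from_blocks\<close>).

  To apply this, the admissible set must be invariant under the scheme
  (\<open>admissible_sp_invariant\<close>) and the field must be Lipschitz near the equilibrium
  (\<open>lipschitz_near_sp_field\<close>). Moreover, an equilibrium satisfies \<open>L x = 0\<close> and \<open>h(x) + L\<^sub>q \<zeta> = 0\<close>, because
  the origin is the only zero of the output field \<open>Gc\<close>
  (\<open>sp_equilibrium_consensus_feasible\<close>). Therefore the two residuals in the claimed estimate are bounded
  by the distance to the equilibrium, and conversely the neighbourhood in which the
  continuous-time estimate is valid contains a ball of admissible states.
\<close>

section \<open>The Euler scheme near an exponentially stable equilibrium\<close>

text \<open>
  Along a solution that stays within distance \<open>R\<close> of the equilibrium the velocity is at most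
  \<open>K R\<close>, because \<open>V\<close> vanishes at \<open>p\<close>; hence over a time \<open>u\<close> the position moves by at most \<open>u K R\<close>
  and the velocity changes by at most \<open>u K\<^sup>2 R\<close>. The point is that the bound is proportional to \<open>R\<close>,
  and that it only asks for Lipschitz continuity of \<open>V\<close>, not for a second derivative of \<open>y\<close>.
\<close>

lemma euler_truncation_error:
  assumes sol: "solution V y" and K: "K-lipschitz_on (ball p e) V" and eq: "V p = 0"
    and near: "\<And>t. t \<ge> 0 \<Longrightarrow> norm (y t - p) \<le> R" and "R < e" and "0 \<le> t" "0 \<le> u"
  shows "norm (y (t + u) - y t - u *\<^sub>R V (y t)) \<le> u * (u * (K\<^sup>2 * R))"
proof -
  have Kn: "K \<ge> 0" using K by (rule lipschitz_on_nonneg)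
  have Rn: "R \<ge> 0" using order_trans[OF norm_ge_zero near[of 0]] by simp
  have pe: "p \<in> ball p e" using Rn \<open>R < e\<close> by simp
  have inb: "y a \<in> ball p e" if "a \<ge> 0" for a
    using near[OF that] \<open>R < e\<close> by (simp add: dist_norm norm_minus_commute)
  have lip: "norm (V w - V w') \<le> K * norm (w - w')" if "w \<in> ball p e" "w' \<in> ball p e" for w w'
    using lipschitz_on_normD[OF K that] .
  have deriv: "(y has_vector_derivative V (y a)) (at a within A)" if "a \<in> A" "A \<subseteq> {0..}" for a A
    using sol that unfolding solution_def
    by (meson atLeast_iff has_vector_derivative_within_subset subsetD)
  have speed: "norm (V (y a)) \<le> K * R" if "a \<ge> 0" for a
  proof -
    have "norm (V (y a)) \<le> K * norm (y a - p)" using lip[OF inb[OF that] pe] eq by simp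
    also have "\<dots> \<le> K * R" using near[OF that] Kn by (rule mult_left_mono)
    finally show ?thesis .
  qed
  \<comment> \<open>A first, crude application of the mean value inequality, needed to bound the velocity change.\<close>
  have inc: "norm (y (t + w) - y t) \<le> w * (K * R)" if "w \<ge> 0" for w
  proof -
    have "norm (y (t + w) - y t) \<le> (K * R) * norm ((t + w) - t)"
    proof (rule differentiable_bound[where S="{0..}" and f'="\<lambda>a h. h *\<^sub>R V (y a)"])
      fix a :: real assume a: "a \<in> {0..}"
      show "(y has_derivative (\<lambda>h. h *\<^sub>R V (y a))) (at a within {0..})"
        using deriv[OF a] by (simp add: has_vector_derivative_def)
      show "onorm (\<lambda>h. h *\<^sub>R V (y a)) \<le> K * R"
        using speed[of a] a by (simp add: onorm_scaleR_left[OF bounded_linear_ident] onorm_id)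
    qed (use \<open>0 \<le> t\<close> that in auto)
    then show ?thesis using that by (simp add: mult.commute)
  qed
  have "norm (y (t + u) - y t - ((t + u) - t) *\<^sub>R V (y t)) \<le> norm ((t + u) - t) * (u * (K\<^sup>2 * R))"
  proof (rule vector_differentiable_bound_linearization[where S="{t..t+u}" and f'="\<lambda>a. V (y a)"])
    fix a assume a: "a \<in> {t..t+u}"
    show "(y has_vector_derivative V (y a)) (at a within {t..t+u})"
      using a \<open>0 \<le> t\<close> by (intro deriv) auto
    have "norm (y a - y t) \<le> (a - t) * (K * R)" using inc[of "a - t"] a by simp
    also have "\<dots> \<le> u * (K * R)" using a Kn Rn by (intro mult_right_mono) auto
    finally have "K * norm (y a - y t) \<le> K * (u * (K * R))" using Kn by (rule mult_left_mono)
    moreover have "norm (V (y a) - V (y t)) \<le> K * norm (y a - y t)"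
      using a \<open>0 \<le> t\<close> by (intro lip inb) auto
    ultimately show "norm (V (y a) - V (y t)) \<le> u * (K\<^sup>2 * R)"
      by (simp add: power2_eq_square mult_ac)
  qed (use \<open>0 \<le> u\<close> in \<open>auto simp: closed_segment_eq_real_ivl\<close>)
  then show "norm (y (t + u) - y t - u *\<^sub>R V (y t)) \<le> u * (u * (K\<^sup>2 * R))"
    using \<open>0 \<le> u\<close> by simp
qed

text \<open>
  Discrete Gronwall argument: the error obeys \<open>E\<^sub>k\<^sub>+\<^sub>1 \<le> (1 + K T) E\<^sub>k + T c\<close> with \<open>c = T K\<^sup>2 R\<close>. The
  recursion is available only while the iterates stay in the ball on which \<open>V\<close> is Lipschitz; the
  smallness hypothesis makes the error bound itself guarantee this, so both are proved in one
  induction. On a fixed time horizon \<open>M\<close> the result is \<open>O(T) R\<close>.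
\<close>

lemma euler_global_error:
  fixes s :: "nat \<Rightarrow> 'a::real_normed_vector"
  assumes sol: "solution V y" and K: "K-lipschitz_on (ball p e) V" and eq: "V p = 0"
    and near: "\<And>t. t \<ge> 0 \<Longrightarrow> norm (y t - p) \<le> R"
    and init: "s 0 = y 0" and euler: "\<And>k. s (Suc k) = s k + T *\<^sub>R V (s k)"
    and "T > 0" and small: "exp (K * M) * M * (T * (K\<^sup>2 * R)) + R < e"
    and "real k * T \<le> M"
  shows "norm (s k - y (k * T)) \<le> exp (K * M) * M * (T * (K\<^sup>2 * R))"
proof -
  define c where "c = T * (K\<^sup>2 * R)"
  have Kn: "K \<ge> 0" using K by (rule lipschitz_on_nonneg)
  have Rn: "R \<ge> 0" using order_trans[OF norm_ge_zero near[of 0]] by simp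
  have cn: "c \<ge> 0" using \<open>T > 0\<close> Rn by (simp add: c_def)
  have uniform: "exp (K * (j * T)) * (j * T) * c \<le> exp (K * M) * M * c" if "real j * T \<le> M" for j
    using that \<open>T > 0\<close> Kn cn by (intro mult_right_mono mult_mono) (auto intro: mult_left_mono)
  have "M \<ge> 0" using \<open>real k * T \<le> M\<close> \<open>T > 0\<close>
    by (meson dual_order.trans less_imp_le mult_nonneg_nonneg of_nat_0_le_iff)
  then have "exp (K * M) * M * c \<ge> 0" using cn by simp
  then have "R < e" using small by (simp add: c_def)
  \<comment> \<open>The induction needs the bound that grows with the elapsed time \<open>k T\<close>.\<close>
  have "norm (s k - y (k * T)) \<le> exp (K * (k * T)) * (k * T) * c" using \<open>real k * T \<le> M\<close>
  proof (induction k)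
    case 0
    then show ?case using init by simp
  next
    case (Suc k)
    define E where "E = norm (s k - y (k * T))"
    have kM: "real k * T \<le> M" using Suc.prems \<open>T > 0\<close> by (simp add: algebra_simps)
    have IH: "E \<le> exp (K * (k * T)) * (k * T) * c" using Suc.IH[OF kM] by (simp add: E_def)
    have kT: "real k * T \<ge> 0" using \<open>T > 0\<close> by simp
    have yb: "y (k * T) \<in> ball p e"
      using near[OF kT] \<open>R < e\<close> by (simp add: dist_norm norm_minus_commute)
    have "norm (s k - p) \<le> E + norm (y (k * T) - p)"
      unfolding E_def using norm_triangle_ineq[of "s k - y (k * T)" "y (k * T) - p"] by simp
    also have "\<dots> < e" using IH uniform[OF kM] near[OF kT] small by (simp add: c_def)
    finally have sb: "s k \<in> ball p e" by (simp add: dist_norm norm_minus_commute)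
    have trunc: "norm (y (k * T + T) - y (k * T) - T *\<^sub>R V (y (k * T))) \<le> T * c"
      using euler_truncation_error[OF sol K eq near \<open>R < e\<close> kT, of T] \<open>T > 0\<close> by (simp add: c_def)
    have stab: "norm (V (s k) - V (y (k * T))) \<le> K * E"
      unfolding E_def using lipschitz_on_normD[OF K sb yb] .
    \<comment> \<open>Propagated error plus the new truncation error.\<close>
    have "s (Suc k) - y (Suc k * T) = (s k - y (k * T)) + T *\<^sub>R (V (s k) - V (y (k * T)))
        - (y (k * T + T) - y (k * T) - T *\<^sub>R V (y (k * T)))"
      by (simp add: euler algebra_simps)
    also have "norm \<dots> \<le> norm (s k - y (k * T)) + norm (T *\<^sub>R (V (s k) - V (y (k * T))))
        + norm (y (k * T + T) - y (k * T) - T *\<^sub>R V (y (k * T)))"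
      by (meson add_mono norm_triangle_ineq norm_triangle_ineq4 order_refl order_trans)
    also have "\<dots> \<le> E + T * (K * E) + T * c"
      using trunc stab \<open>T > 0\<close> by (auto simp: E_def intro!: add_mono)
    also have "\<dots> = (1 + K * T) * E + T * c" by (simp add: algebra_simps)
    also have "\<dots> \<le> exp (K * T) * (exp (K * (k * T)) * (k * T) * c) + exp (K * (Suc k * T)) * (T * c)"
    proof (rule add_mono)
      show "(1 + K * T) * E \<le> exp (K * T) * (exp (K * (k * T)) * (k * T) * c)"
        using IH Kn \<open>T > 0\<close> by (intro mult_mono exp_ge_add_one_self) (auto simp: E_def)
      have "K * (Suc k * T) \<ge> 0" using Kn \<open>T > 0\<close> by (intro mult_nonneg_nonneg) auto
      then show "T * c \<le> exp (K * (Suc k * T)) * (T * c)"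
        using mult_right_mono[of 1 "exp (K * (Suc k * T))" "T * c"] cn \<open>T > 0\<close> by simp
    qed
    also have "exp (K * T) * (exp (K * (k * T)) * (k * T) * c) = exp (K * (Suc k * T)) * (k * T * c)"
      by (simp add: exp_add[symmetric] algebra_simps)
    also have "\<dots> + exp (K * (Suc k * T)) * (T * c) = exp (K * (Suc k * T)) * (Suc k * T) * c"
      by (simp add: algebra_simps)
    finally show ?case .
  qed
  also have "\<dots> \<le> exp (K * M) * M * c" using uniform \<open>real k * T \<le> M\<close> .
  finally show ?thesis by (simp add: c_def)
qed

text \<open>
  If every admissible run that starts in the \<open>\<delta>\<close>-ball contracts by \<open>q ^ m\<close> over \<open>m\<close> steps, then it
  returns to the \<open>\<delta>\<close>-ball, and the estimate restarts there. An incomplete last block costs at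
  most the factor \<open>C / q ^ m\<close>. The predicate \<open>P\<close> stands for being a run of the iteration; it
  must be stable under shifting time.
\<close>

lemma geometric_decay_from_blocks:
  fixes s :: "nat \<Rightarrow> 'a::real_normed_vector"
  assumes invariant: "\<And>k. s k \<in> S"
    and autonomous: "\<And>j. P (\<lambda>k. s (j + k))"
    and block: "\<And>s. P s \<Longrightarrow> s 0 \<in> S \<Longrightarrow> norm (s 0 - p) < \<delta> \<Longrightarrow>
          (\<forall>k\<le>m. norm (s k - p) \<le> C * norm (s 0 - p)) \<and> norm (s m - p) \<le> q ^ m * norm (s 0 - p)"
    and "0 < q" "q \<le> 1" "m > 0" and small: "norm (s 0 - p) < \<delta>" and "C \<ge> 0"
  shows "norm (s k - p) \<le> (C / q ^ m) * q ^ k * norm (s 0 - p)"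
proof -
  have blocks: "norm (s (j * m) - p) \<le> q ^ (j * m) * norm (s 0 - p)" for j
  proof (induction j)
    case (Suc j)
    have "q ^ (j * m) \<le> 1" using \<open>0 < q\<close> \<open>q \<le> 1\<close> by (simp add: power_le_one)
    then have "norm (s (j * m) - p) < \<delta>"
      using Suc small by (smt (verit) mult_left_le_one_le norm_ge_zero \<open>0 < q\<close> zero_le_power)
    then have "norm (s (j * m + m) - p) \<le> q ^ m * norm (s (j * m) - p)"
      using block[OF autonomous[of "j * m"]] invariant by simp
    also have "\<dots> \<le> q ^ m * (q ^ (j * m) * norm (s 0 - p))"
      using Suc \<open>0 < q\<close> by (intro mult_left_mono) auto
    finally show ?case by (simp add: power_add algebra_simps)
  qed simp
  define j i where "j = k div m" and "i = k mod m"
  have k: "k = j * m + i" and "i < m" using \<open>m > 0\<close> by (auto simp: j_def i_def)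
  have "q ^ (j * m) \<le> 1" using \<open>0 < q\<close> \<open>q \<le> 1\<close> by (simp add: power_le_one)
  then have "norm (s (j * m) - p) < \<delta>"
    using blocks[of j] small by (smt (verit) mult_left_le_one_le norm_ge_zero \<open>0 < q\<close> zero_le_power)
  then have "norm (s (j * m + i) - p) \<le> C * norm (s (j * m) - p)"
    using block[OF autonomous[of "j * m"]] invariant \<open>i < m\<close> by simp
  also have "\<dots> \<le> C * (q ^ (j * m) * norm (s 0 - p))"
    using blocks \<open>C \<ge> 0\<close> by (intro mult_left_mono)
  also have "q ^ (j * m) \<le> q ^ k / q ^ m"
  proof -
    have "q ^ m \<le> q ^ i" using \<open>i < m\<close> \<open>0 < q\<close> \<open>q \<le> 1\<close> by (intro power_decreasing) auto
    then show ?thesis using \<open>0 < q\<close> by (simp add: k power_add field_simps)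
  qed
  finally show ?thesis using \<open>C \<ge> 0\<close> k by (simp add: mult_left_mono mult_right_mono mult.assoc)
qed

text \<open>
  Let a run start at distance \<open>r\<close> from \<open>p\<close>. The horizon \<open>M\<close> is chosen so long that the flow has used
  the gap between the rates to beat its own constant: at times \<open>t \<ge> M\<close> it is within
  \<open>exp (- \<beta> t) r / 2\<close>. Up to time \<open>M + 1\<close> the Euler error is at most \<open>T B r\<close>, and \<open>T\<close> is taken so
  small that this is also at most \<open>exp (- \<beta> t) r / 2\<close>. Hence a block of \<open>m\<close> steps with
  \<open>m T \<in> [M, M + 1]\<close> contracts by \<open>exp (- \<beta> m T)\<close>, and blocks can be concatenated.
\<close>

theorem euler_preserves_local_exp_stability:
  fixes V :: "'a::real_normed_vector \<Rightarrow> 'a"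
  assumes "e > 0" and K: "K-lipschitz_on (ball p e) V" and eq: "V p = 0"
    and invariant: "\<And>s T. s \<in> S \<Longrightarrow> s + T *\<^sub>R V s \<in> S"
    and "\<delta>0 > 0" and "C0 \<ge> 0"
    and stable: "\<And>y0. y0 \<in> S \<Longrightarrow> norm (y0 - p) < \<delta>0 \<Longrightarrow>
          \<exists>y. y 0 = y0 \<and> solution V y \<and>
              (\<forall>t\<ge>0. norm (y t - p) \<le> C0 * exp (- \<alpha> * t) * norm (y0 - p))"
    and "0 < \<beta>" and "\<beta> < \<alpha>"
  shows "\<exists>T0>0. \<exists>C>0. \<exists>\<delta>>0. \<forall>T s. 0 < T \<and> T < T0 \<and> s 0 \<in> S \<and>
      (\<forall>k. s (Suc k) = s k + T *\<^sub>R V (s k)) \<and> norm (s 0 - p) < \<delta> \<longrightarrow>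
      (\<forall>k. norm (s k - p) \<le> C * exp (- \<beta> * real k * T) * norm (s 0 - p))"
proof -
  have Kn: "K \<ge> 0" using K by (rule lipschitz_on_nonneg)
  \<comment> \<open>Enlarged to be positive, since its logarithm is taken.\<close>
  define C1 where "C1 = C0 + 1"
  have C1: "C1 > 0" "C0 \<le> C1" using \<open>C0 \<ge> 0\<close> by (auto simp: C1_def)
  define M where "M = max 1 (ln (2 * C1) / (\<alpha> - \<beta>))"
  have M: "M > 0" "C1 * exp (- (\<alpha> - \<beta>) * M) \<le> 1 / 2"
  proof -
    show "M > 0" by (simp add: M_def)
    have "ln (2 * C1) \<le> (\<alpha> - \<beta>) * M"
      using \<open>\<beta> < \<alpha>\<close> by (simp add: M_def field_simps max_def)
    then have "2 * C1 \<le> exp ((\<alpha> - \<beta>) * M)" using C1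
      by (metis exp_le_cancel_iff exp_ln mult_pos_pos zero_less_numeral)
    then have "2 * C1 * exp (- (\<alpha> - \<beta>) * M) \<le> exp ((\<alpha> - \<beta>) * M) * exp (- (\<alpha> - \<beta>) * M)"
      by (intro mult_right_mono) auto
    then show "C1 * exp (- (\<alpha> - \<beta>) * M) \<le> 1 / 2" by (simp add: exp_add[symmetric] algebra_simps)
  qed
  define B where "B = exp (K * (M + 1)) * (M + 1) * (K\<^sup>2 * C1)"
  have Bn: "B \<ge> 0" using M C1 by (simp add: B_def)
  \<comment> \<open>The bound 1 ensures that \<open>m = \<lceil>M / T\<rceil>\<close> steps end before time \<open>M + 1\<close>; the other one makes the
      Euler error at most half of the required decay, and \<open>B + 1\<close> avoids a division by zero.\<close>
  define T0 where "T0 = min 1 (exp (- \<beta> * (M + 1)) / (2 * (B + 1)))"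
  define \<delta> where "\<delta> = min \<delta>0 (e / (C1 + 1))"
  have "T0 > 0" "\<delta> > 0" using Bn C1 \<open>\<delta>0 > 0\<close> \<open>e > 0\<close> by (auto simp: T0_def \<delta>_def)
  have block: "(\<forall>k. real k * T \<le> M + 1 \<longrightarrow> norm (s k - p) \<le> (C1 + 1) * norm (s 0 - p)) \<and>
      (\<forall>k. M \<le> real k * T \<and> real k * T \<le> M + 1 \<longrightarrow> norm (s k - p) \<le> exp (- \<beta> * T) ^ k * norm (s 0 - p))"
    if T: "0 < T" "T < T0" and s: "s 0 \<in> S" "\<forall>k. s (Suc k) = s k + T *\<^sub>R V (s k)"
      and small: "norm (s 0 - p) < \<delta>" for T and s :: "nat \<Rightarrow> 'a"
  proof -
    define r where "r = norm (s 0 - p)"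
    have rn: "r \<ge> 0" by (simp add: r_def)
    obtain y where y: "y 0 = s 0" "solution V y"
      and yb: "\<And>t. t \<ge> 0 \<Longrightarrow> norm (y t - p) \<le> C0 * exp (- \<alpha> * t) * r"
      using stable[OF s(1)] small by (auto simp: r_def \<delta>_def)
    have decay: "norm (y t - p) \<le> C1 * exp (- \<alpha> * t) * r" if "t \<ge> 0" for t
      using yb[OF that] C1 rn by (smt (verit, best) exp_ge_zero mult_right_mono)
    have near: "norm (y t - p) \<le> C1 * r" if "t \<ge> 0" for t
    proof -
      have "C1 * exp (- \<alpha> * t) * r \<le> C1 * 1 * r"
        using that \<open>0 < \<beta>\<close> \<open>\<beta> < \<alpha>\<close> C1 rn by (intro mult_right_mono mult_left_mono) auto
      then show ?thesis using decay[OF that] by simp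
    qed
    have TB: "T * B \<le> exp (- \<beta> * (M + 1)) / 2"
    proof -
      have "T * B \<le> T * (B + 1)" using T by simp
      also have "\<dots> \<le> exp (- \<beta> * (M + 1)) / (2 * (B + 1)) * (B + 1)"
        using T Bn by (intro mult_right_mono) (auto simp: T0_def)
      also have "\<dots> = exp (- \<beta> * (M + 1)) / 2"
        using Bn nonzero_divide_mult_cancel_right[of "B + 1"] by (simp add: divide_simps)
      finally show ?thesis .
    qed
    have "exp (- \<beta> * (M + 1)) \<le> 1" using \<open>0 < \<beta>\<close> M by simp
    then have TB1: "T * B \<le> 1" using TB by linarith
    have err_eq: "exp (K * (M + 1)) * (M + 1) * (T * (K\<^sup>2 * (C1 * r))) = T * B * r"
      by (simp add: B_def)
    have "T * B * r + C1 * r \<le> (C1 + 1) * r"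
      using mult_right_mono[OF TB1 rn] by (simp add: algebra_simps)
    also have "\<dots> < e"
      using small C1 by (simp add: r_def \<delta>_def field_simps)
    finally have "exp (K * (M + 1)) * (M + 1) * (T * (K\<^sup>2 * (C1 * r))) + C1 * r < e"
      by (simp only: err_eq)
    then have err: "norm (s k - y (k * T)) \<le> T * B * r" if "real k * T \<le> M + 1" for k
      using euler_global_error[where s=s and y=y and V=V and T=T and k=k and M="M + 1" and R="C1 * r",
          OF y(2) K eq _ _ _ T(1) _ that] near y(1) s(2)
      unfolding err_eq by metis
    have tri: "norm (s k - p) \<le> norm (s k - y (k * T)) + norm (y (k * T) - p)" for k
      using norm_triangle_ineq[of "s k - y (k * T)" "y (k * T) - p"] by simp
    have kT: "real k * T \<ge> 0" for k using T by simp
    have "norm (s k - p) \<le> (C1 + 1) * r" if "real k * T \<le> M + 1" for k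
      using tri[of k] err[OF that] near[OF kT, of k] mult_right_mono[OF TB1 rn]
      by (simp add: algebra_simps)
    moreover have "norm (s k - p) \<le> exp (- \<beta> * T) ^ k * r"
      if k: "M \<le> real k * T" "real k * T \<le> M + 1" for k
    proof -
      have pow: "exp (- \<beta> * T) ^ k = exp (- \<beta> * (k * T))"
        by (simp add: exp_of_nat_mult[symmetric] mult_ac)
      have "C1 * exp (- \<alpha> * (k * T)) = C1 * exp (- (\<alpha> - \<beta>) * (k * T)) * exp (- \<beta> * (k * T))"
        by (simp add: exp_add[symmetric] algebra_simps)
      also have "\<dots> \<le> (C1 * exp (- (\<alpha> - \<beta>) * M)) * exp (- \<beta> * (k * T))"
        using k \<open>\<beta> < \<alpha>\<close> C1 by (intro mult_right_mono mult_left_mono) auto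
      also have "\<dots> \<le> 1 / 2 * exp (- \<beta> * (k * T))"
        by (intro mult_right_mono M) auto
      finally have flow: "C1 * exp (- \<alpha> * (k * T)) * r \<le> 1 / 2 * exp (- \<beta> * (k * T)) * r"
        using rn by (rule mult_right_mono)
      have "exp (- \<beta> * (M + 1)) \<le> exp (- \<beta> * (k * T))" using k \<open>0 < \<beta>\<close> by simp
      then have "T * B * r \<le> 1 / 2 * exp (- \<beta> * (k * T)) * r"
        using TB rn by (intro mult_right_mono) linarith+
      then show ?thesis
        using tri[of k] err[OF k(2)] decay[OF kT, of k] flow unfolding pow by simp
    qed
    ultimately show ?thesis by (simp add: r_def)
  qed
  define C where "C = (C1 + 1) * exp (\<beta> * (M + 1))"
  have "C > 0" using C1 by (simp add: C_def)
  have decay: "norm (s k - p) \<le> C * exp (- \<beta> * real k * T) * norm (s 0 - p)"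
    if T: "0 < T" "T < T0" and s: "s 0 \<in> S" "\<And>k. s (Suc k) = s k + T *\<^sub>R V (s k)"
      and small: "norm (s 0 - p) < \<delta>" for T s k
  proof -
    define m where "m = nat \<lceil>M / T\<rceil>"
    define q where "q = exp (- \<beta> * T)"
    have "real m = of_int \<lceil>M / T\<rceil>" using M T by (simp add: m_def)
    then have "M / T \<le> real m" "real m < M / T + 1" by linarith+
    then have "M \<le> real m * T" "real m * T < M + T" using T by (auto simp: field_simps)
    then have mT: "M \<le> real m * T" "real m * T \<le> M + 1" using T by (auto simp: T0_def)
    have "m > 0" using mT(1) M by (intro gr0I) auto
    have q: "0 < q" "q \<le> 1" using T \<open>0 < \<beta>\<close> by (auto simp: q_def)
    have inv: "s k \<in> S" for k by (induction k) (auto simp: s intro: invariant)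
    have "norm (s k - p) \<le> ((C1 + 1) / q ^ m) * q ^ k * norm (s 0 - p)"
    proof (rule geometric_decay_from_blocks[where S=S and P="\<lambda>s. \<forall>k. s (Suc k) = s k + T *\<^sub>R V (s k)"])
      fix s :: "nat \<Rightarrow> 'a"
      assume s: "\<forall>k. s (Suc k) = s k + T *\<^sub>R V (s k)" "s 0 \<in> S" "norm (s 0 - p) < \<delta>"
      have "real k * T \<le> M + 1" if "k \<le> m" for k
        using that mT(2) T by (smt (verit, best) mult_right_mono of_nat_le_iff)
      then show "(\<forall>k\<le>m. norm (s k - p) \<le> (C1 + 1) * norm (s 0 - p)) \<and>
          norm (s m - p) \<le> q ^ m * norm (s 0 - p)"
        using block[OF T s(2,1,3)] mT by (auto simp: q_def)
    qed (use inv q \<open>m > 0\<close> small C1 in \<open>auto simp: s\<close>)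
    also have "\<dots> \<le> C * exp (- \<beta> * real k * T) * norm (s 0 - p)"
    proof -
      have "q ^ m = exp (- \<beta> * (m * T))" "q ^ k = exp (- \<beta> * real k * T)"
        by (simp_all add: q_def exp_of_nat_mult[symmetric] mult_ac)
      moreover have "1 / exp (- \<beta> * (m * T)) \<le> exp (\<beta> * (M + 1))"
        using mult_left_mono[OF mT(2), of \<beta>] \<open>0 < \<beta>\<close> by (simp add: exp_minus inverse_eq_divide)
      then have "(C1 + 1) / exp (- \<beta> * (m * T)) \<le> C"
        using C1 mult_left_mono[of _ _ "C1 + 1"] by (fastforce simp: C_def)
      ultimately show ?thesis by (simp only:) (intro mult_right_mono; simp)
    qed
    finally show ?thesis .
  qed
  show ?thesis
  proof (rule exI[of _ T0], rule conjI, fact, rule exI[of _ C], rule conjI, fact,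
      rule exI[of _ \<delta>], rule conjI, fact, intro allI impI)
    fix T s k
    assume "0 < T \<and> T < T0 \<and> s 0 \<in> S \<and> (\<forall>k. s (Suc k) = s k + T *\<^sub>R V (s k)) \<and> norm (s 0 - p) < \<delta>"
    then show "norm (s k - p) \<le> C * exp (- \<beta> * real k * T) * norm (s 0 - p)"
      using decay by blast
  qed
qed

section \<open>Maps that are Lipschitz near a point\<close>

text \<open>
  A pointwise notion, as the stability argument happens at a single equilibrium. The
  carrier \<open>S\<close> is there for maps that are smooth only on a linear subspace.
\<close>

definition lipschitz_near :: "'a::metric_space set \<Rightarrow> 'a \<Rightarrow> ('a \<Rightarrow> 'b::metric_space) \<Rightarrow> bool" where
  "lipschitz_near S p g \<longleftrightarrow> (\<exists>e>0. \<exists>B. B-lipschitz_on (ball p e \<inter> S) g)"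

lemma lipschitz_nearI: "e > 0 \<Longrightarrow> B-lipschitz_on (ball p e \<inter> S) g \<Longrightarrow> lipschitz_near S p g"
  unfolding lipschitz_near_def by blast

lemma lipschitz_nearE:
  assumes "lipschitz_near S p g"
  obtains e B where "e > 0" "B > 0" "B-lipschitz_on (ball p e \<inter> S) g"
proof -
  from assms obtain e B where *: "e > 0" "B-lipschitz_on (ball p e \<inter> S) g"
    unfolding lipschitz_near_def by blast
  have "(\<bar>B\<bar> + 1)-lipschitz_on (ball p e \<inter> S) g"
    using *(2) by (rule lipschitz_on_mono) auto
  then show thesis using that[of e "\<bar>B\<bar> + 1"] *(1) by auto
qed

lemma lipschitz_near_compose:
  assumes g: "lipschitz_near S p g" and k: "lipschitz_near R (g p) k" and "g ` S \<subseteq> R" and "p \<in> S"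
  shows "lipschitz_near S p (\<lambda>x. k (g x))"
proof -
  obtain e B where e: "e > 0" "B > 0" "B-lipschitz_on (ball p e \<inter> S) g" by (rule lipschitz_nearE[OF g])
  obtain e' B' where e': "e' > 0" "B' > 0" "B'-lipschitz_on (ball (g p) e' \<inter> R) k"
    by (rule lipschitz_nearE[OF k])
  define d where "d = min e (e' / B)"
  have d: "d > 0" using e e' by (simp add: d_def)
  have g': "B-lipschitz_on (ball p d \<inter> S) g"
    using e(3) by (rule lipschitz_on_subset) (auto simp: d_def)
  have "g ` (ball p d \<inter> S) \<subseteq> ball (g p) e' \<inter> R"
  proof safe
    fix x assume x: "x \<in> ball p d" "x \<in> S"
    have "dist (g p) (g x) \<le> B * dist p x"
      using d \<open>p \<in> S\<close> x by (intro lipschitz_onD[OF g']) auto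
    also have "\<dots> < e'" using x(1) e(2) by (simp add: d_def field_simps)
    finally show "g x \<in> ball (g p) e'" by simp
    show "g x \<in> R" using x \<open>g ` S \<subseteq> R\<close> by auto
  qed
  then have "B'-lipschitz_on (g ` (ball p d \<inter> S)) k"
    using e'(3) by (metis lipschitz_on_subset)
  from lipschitz_on_compose2[OF g' this] show ?thesis using d by (blast intro: lipschitz_nearI)
qed

lemma lipschitz_near_const: "lipschitz_near S p (\<lambda>x. c)"
  by (rule lipschitz_nearI[of 1]) (auto intro: lipschitz_on_constant)

lemma lipschitz_near_bounded_linear:
  assumes "bounded_linear g"
  shows "lipschitz_near S p g"
proof -
  obtain C where "C-lipschitz_on (ball p 1 \<inter> S) g"
    using assms by (rule bounded_linear.lipschitz_boundE)
  then show ?thesis by (intro lipschitz_nearI[of 1]) auto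
qed

lemma lipschitz_near_Pair:
  assumes "lipschitz_near S p g" "lipschitz_near S p k"
  shows "lipschitz_near S p (\<lambda>x. (g x, k x))"
proof -
  from assms obtain e B e' B' where *: "e > 0" "B-lipschitz_on (ball p e \<inter> S) g"
    "e' > 0" "B'-lipschitz_on (ball p e' \<inter> S) k"
    unfolding lipschitz_near_def by blast
  then have "B-lipschitz_on (ball p (min e e') \<inter> S) g" "B'-lipschitz_on (ball p (min e e') \<inter> S) k"
    by (auto elim!: lipschitz_on_subset)
  from lipschitz_on_Pair[OF this] show ?thesis using * by (intro lipschitz_nearI[of "min e e'"]) auto
qed

lemma lipschitz_near_bounded_linear_compose:
  assumes "bounded_linear k" "lipschitz_near UNIV p g"
  shows "lipschitz_near UNIV p (\<lambda>x. k (g x))"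
  using lipschitz_near_compose[OF assms(2) lipschitz_near_bounded_linear[OF assms(1)], of UNIV] by simp

lemma lipschitz_near_add:
  fixes g k :: "'a::metric_space \<Rightarrow> 'b::real_normed_vector"
  assumes "lipschitz_near UNIV p g" "lipschitz_near UNIV p k"
  shows "lipschitz_near UNIV p (\<lambda>x. g x + k x)"
proof -
  have "bounded_linear (\<lambda>z :: 'b \<times> 'b. fst z + snd z)"
    by (intro bounded_linear_add bounded_linear_fst bounded_linear_snd)
  from lipschitz_near_bounded_linear_compose[OF this lipschitz_near_Pair[OF assms]] show ?thesis by simp
qed

lemma
  fixes g :: "'a::metric_space \<Rightarrow> 'b::real_normed_vector"
  assumes g: "lipschitz_near UNIV p g"
  shows lipschitz_near_scaleR: "lipschitz_near UNIV p (\<lambda>x. c *\<^sub>R g x)"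
    and lipschitz_near_uminus: "lipschitz_near UNIV p (\<lambda>x. - g x)"
  using lipschitz_near_bounded_linear_compose[OF bounded_linear_scaleR_right g]
    lipschitz_near_bounded_linear_compose[OF bounded_linear_minus[OF bounded_linear_ident] g]
  by auto

lemma
  fixes g :: "'a::metric_space \<Rightarrow> 'b::real_normed_vector \<times> 'c::real_normed_vector"
  assumes g: "lipschitz_near UNIV p g"
  shows lipschitz_near_fst: "lipschitz_near UNIV p (\<lambda>x. fst (g x))"
    and lipschitz_near_snd: "lipschitz_near UNIV p (\<lambda>x. snd (g x))"
  using lipschitz_near_bounded_linear_compose[OF bounded_linear_fst g]
    lipschitz_near_bounded_linear_compose[OF bounded_linear_snd g]
  by auto

lemma lipschitz_near_ident: "lipschitz_near S p (\<lambda>x. x)"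
  by (rule lipschitz_nearI[of 1]) (auto intro: lipschitz_on_id)

lemma lipschitz_near_vec_nth:
  fixes g :: "'a::metric_space \<Rightarrow> 'b::real_normed_vector ^ 'n"
  assumes "lipschitz_near UNIV p g"
  shows "lipschitz_near UNIV p (\<lambda>x. g x $ i)"
  using lipschitz_near_bounded_linear_compose[OF bounded_linear_vec_nth assms] .

lemmas lipschitz_near_intros = lipschitz_near_Pair lipschitz_near_add lipschitz_near_scaleR
  lipschitz_near_uminus lipschitz_near_fst lipschitz_near_snd lipschitz_near_vec_nth
  lipschitz_near_ident

lemma lipschitz_near_vec:
  fixes g :: "'a::metric_space \<Rightarrow> ('b::euclidean_space)^'n"
  assumes "\<And>i. lipschitz_near UNIV p (\<lambda>x. g x $ i)"
  shows "lipschitz_near UNIV p g"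
proof -
  have "lipschitz_near UNIV p (\<lambda>x. \<Sum>i\<in>I. axis i (g x $ i))" if "finite I" for I :: "'n set"
    using that
  proof induction
    case (insert i I)
    have "linear (axis i :: 'b \<Rightarrow> 'b^'n)"
      by (rule linearI) (auto simp: axis_def vec_eq_iff)
    then have "bounded_linear (axis i :: 'b \<Rightarrow> 'b^'n)" by (rule linear_conv_bounded_linear[THEN iffD1])
    from lipschitz_near_bounded_linear_compose[OF this assms] insert show ?case
      by (simp add: lipschitz_near_add)
  qed (simp add: lipschitz_near_const)
  moreover have "(\<Sum>i\<in>UNIV. axis i (v $ i)) = v" for v :: "'b^'n"
    by (simp add: vec_eq_iff axis_def)
  ultimately show ?thesis by (metis (no_types, lifting) ext finite)
qed

text \<open>On a ball both factors are bounded, so the usual product rule for increments applies.\<close>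

lemma lipschitz_near_bilinear:
  fixes g :: "'a::metric_space \<Rightarrow> 'b::euclidean_space" and k :: "'a \<Rightarrow> 'c::euclidean_space"
    and prod :: "'b \<Rightarrow> 'c \<Rightarrow> 'd::real_normed_vector"
  assumes g: "lipschitz_near UNIV p g" and k: "lipschitz_near UNIV p k" and "bilinear prod"
  shows "lipschitz_near UNIV p (\<lambda>x. prod (g x) (k x))"
proof -
  interpret bounded_bilinear prod using \<open>bilinear prod\<close> bilinear_conv_bounded_bilinear by blast
  obtain P where P: "P > 0" "\<And>a b. norm (prod a b) \<le> norm a * norm b * P" using pos_bounded by blast
  obtain e B where e: "e > 0" "B > 0" "B-lipschitz_on (ball p e \<inter> UNIV) g" by (rule lipschitz_nearE[OF g])
  obtain e' B' where e': "e' > 0" "B' > 0" "B'-lipschitz_on (ball p e' \<inter> UNIV) k"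
    by (rule lipschitz_nearE[OF k])
  define d where "d = min e e'"
  have d: "d > 0" using e e' by (simp add: d_def)
  have g': "dist (g x) (g y) \<le> B * dist x y" if "x \<in> ball p d" "y \<in> ball p d" for x y
    using that by (intro lipschitz_onD[OF e(3)]) (auto simp: d_def)
  have k': "dist (k x) (k y) \<le> B' * dist x y" if "x \<in> ball p d" "y \<in> ball p d" for x y
    using that by (intro lipschitz_onD[OF e'(3)]) (auto simp: d_def)
  have gn: "norm (g x) \<le> norm (g p) + B * d" if "x \<in> ball p d" for x
  proof -
    have "norm (g x) \<le> norm (g p) + dist (g x) (g p)" by (metis dist_norm norm_triangle_sub)
    also have "dist (g x) (g p) \<le> B * dist x p" using g' that d by simp
    also have "\<dots> \<le> B * d" using that e by (simp add: dist_commute)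
    finally show ?thesis by simp
  qed
  have kn: "norm (k x) \<le> norm (k p) + B' * d" if "x \<in> ball p d" for x
  proof -
    have "norm (k x) \<le> norm (k p) + dist (k x) (k p)" by (metis dist_norm norm_triangle_sub)
    also have "dist (k x) (k p) \<le> B' * dist x p" using k' that d by simp
    also have "\<dots> \<le> B' * d" using that e' by (simp add: dist_commute)
    finally show ?thesis by simp
  qed
  define Q where "Q = (B * (norm (k p) + B' * d) + (norm (g p) + B * d) * B') * P"
  have "Q-lipschitz_on (ball p d \<inter> UNIV) (\<lambda>x. prod (g x) (k x))"
  proof (rule lipschitz_onI)
    show "Q \<ge> 0" using P e e' d by (simp add: Q_def)
    fix x y assume xy: "x \<in> ball p d \<inter> UNIV" "y \<in> ball p d \<inter> UNIV"
    have "prod (g x) (k x) - prod (g y) (k y) = prod (g x - g y) (k x) + prod (g y) (k x - k y)"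
      by (simp add: diff_left diff_right)
    also have "norm \<dots> \<le> norm (g x - g y) * norm (k x) * P + norm (g y) * norm (k x - k y) * P"
      using P(2) by (meson add_mono norm_triangle_le)
    also have "\<dots> \<le> (B * dist x y) * (norm (k p) + B' * d) * P + (norm (g p) + B * d) * (B' * dist x y) * P"
      using xy g'[of x y] k'[of x y] gn[of y] kn[of x] P(1) e e' d
      by (intro add_mono mult_right_mono mult_mono) (auto simp: dist_norm)
    finally show "dist (prod (g x) (k x)) (prod (g y) (k y)) \<le> Q * dist x y"
      by (simp add: Q_def dist_norm algebra_simps)
  qed
  then show ?thesis using d by (rule lipschitz_nearI[rotated])
qed

text \<open>By continuity the derivative is bounded on a small ball, whose trace on \<open>S\<close> is convex.\<close>

lemma C1_on_imp_lipschitz_near: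
  assumes "C1_on S g" "convex S" "p \<in> S"
  shows "lipschitz_near S p g"
proof -
  from assms(1) obtain g' where g': "\<And>x. x \<in> S \<Longrightarrow> (g has_derivative blinfun_apply (g' x)) (at x within S)"
    and c: "continuous_on S g'" unfolding C1_on_def by blast
  from c \<open>p \<in> S\<close> obtain d where d: "d > 0" "\<And>x. x \<in> S \<Longrightarrow> dist x p < d \<Longrightarrow> dist (g' x) (g' p) < 1"
    unfolding continuous_on_iff by (meson zero_less_one)
  have "(norm (g' p) + 1)-lipschitz_on (ball p d \<inter> S) g"
  proof (rule lipschitz_onI)
    fix x y assume xy: "x \<in> ball p d \<inter> S" "y \<in> ball p d \<inter> S"
    have "norm (g x - g y) \<le> (norm (g' p) + 1) * norm (x - y)"
    proof (rule differentiable_bound[OF _ _ _ xy])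
      show "convex (ball p d \<inter> S)" using \<open>convex S\<close> by (intro convex_Int convex_ball)
      fix z assume z: "z \<in> ball p d \<inter> S"
      then show "(g has_derivative blinfun_apply (g' z)) (at z within ball p d \<inter> S)"
        by (intro has_derivative_subset[OF g']) auto
      have "norm (g' z) \<le> norm (g' p) + dist (g' z) (g' p)" by (metis dist_norm norm_triangle_sub)
      also have "\<dots> \<le> norm (g' p) + 1" using d(2)[of z] z by (simp add: dist_commute)
      finally show "onorm (blinfun_apply (g' z)) \<le> norm (g' p) + 1" by (simp add: norm_blinfun.rep_eq)
    qed
    then show "dist (g x) (g y) \<le> (norm (g' p) + 1) * dist x y" by (simp add: dist_norm)
  qed simp
  then show ?thesis using d by (blast intro: lipschitz_nearI)
qed

lemma C2_imp_lipschitz_near: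
  assumes "C2 g"
  shows "lipschitz_near UNIV p g"
proof -
  from assms obtain g' where g': "\<And>x. (g has_derivative blinfun_apply (g' x)) (at x)" and "C1_on UNIV g'"
    unfolding C2_def by blast
  from \<open>C1_on UNIV g'\<close> obtain g'' where "\<And>x. (g' has_derivative blinfun_apply (g'' x)) (at x)"
    unfolding C1_on_def by auto
  then have "continuous_on UNIV g'" by (intro has_derivative_continuous_on)
  with g' have "C1_on UNIV g" unfolding C1_on_def by blast
  then show ?thesis by (intro C1_on_imp_lipschitz_near) auto
qed

lemma grad_eqI: "GDERIV f x :> D \<Longrightarrow> grad f x = D"
  unfolding grad_def
proof (rule the_equality)
  fix D' assume "GDERIV f x :> D" "GDERIV f x :> D'"
  then have "(\<lambda>h. inner h D) = (\<lambda>h. inner h D')"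
    unfolding gderiv_def by (rule has_derivative_unique)
  then have "inner h (D' - D) = 0" for h by (simp add: inner_diff_right fun_eq_iff)
  from this[of "D' - D"] show "D' = D" by simp
qed

text \<open>
  The gradient is the image of the derivative under the bounded linear Riesz map
  \<open>l \<mapsto> \<Sum>b\<in>Basis. l b *\<^sub>R b\<close>, so it inherits the Lipschitz property from the derivative.
\<close>

lemma C2_gradient:
  fixes f :: "'a::euclidean_space \<Rightarrow> real"
  assumes "C2 f"
  shows "GDERIV f x :> grad f x" and "lipschitz_near UNIV p (grad f)"
proof -
  from assms obtain f' where f': "\<And>x. (f has_derivative blinfun_apply (f' x)) (at x)" and C1: "C1_on UNIV f'"
    unfolding C2_def by blast
  define G where "G x = (\<Sum>b\<in>Basis. blinfun_apply (f' x) b *\<^sub>R b)" for x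
  have "inner h (G x) = blinfun_apply (f' x) h" for h x
  proof -
    have "blinfun_apply (f' x) h = blinfun_apply (f' x) (\<Sum>b\<in>Basis. inner h b *\<^sub>R b)"
      by (simp add: euclidean_representation)
    then show ?thesis by (simp add: G_def inner_sum_right blinfun.sum_right blinfun.scaleR_right mult.commute)
  qed
  then have gd: "GDERIV f x :> G x" for x
    using f'[of x] by (simp add: gderiv_def)
  then have grad: "grad f = G" by (auto intro: grad_eqI)
  show "GDERIV f x :> grad f x" using gd by (simp add: grad)
  have "lipschitz_near UNIV p f'" using C1 by (intro C1_on_imp_lipschitz_near) auto
  then have *: "lipschitz_near UNIV p (\<lambda>x. blinfun_apply (f' x) b *\<^sub>R b)" for b
    by (rule lipschitz_near_bounded_linear_compose[rotated])
       (intro bounded_linear_scaleR_const blinfun.bounded_linear_left)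
  have "lipschitz_near UNIV p (\<lambda>x. \<Sum>b\<in>I. blinfun_apply (f' x) b *\<^sub>R b)" if "finite I" for I
    using that by induction (auto intro: lipschitz_near_const lipschitz_near_add *)
  from this[OF finite_Basis] show "lipschitz_near UNIV p (grad f)" by (simp add: grad G_def[abs_def])
qed

lemma grad_separable_sum:
  fixes f :: "'n::finite \<Rightarrow> real^'d \<Rightarrow> real" and x :: "real^'d^'n"
  assumes "\<And>i. C2 (f i)"
  shows "grad (\<lambda>x. \<Sum>i\<in>UNIV. f i (x $ i)) x = (\<chi> i. grad (f i) (x $ i))"
proof (rule grad_eqI, unfold gderiv_def)
  have "((\<lambda>x :: real^'d^'n. f i (x $ i)) has_derivative (\<lambda>v. inner (v $ i) (grad (f i) (x $ i)))) (at x)" for i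
  proof (rule has_derivative_compose[where f="\<lambda>x. x $ i" and g="f i"])
    show "((\<lambda>x :: real^'d^'n. x $ i) has_derivative (\<lambda>v. v $ i)) (at x)"
      by (rule bounded_linear_imp_has_derivative[OF bounded_linear_vec_nth])
    show "(f i has_derivative (\<lambda>v. inner v (grad (f i) (x $ i)))) (at (x $ i))"
      using C2_gradient(1)[OF assms, of i "x $ i"] unfolding gderiv_def .
  qed
  then have "((\<lambda>x :: real^'d^'n. \<Sum>i\<in>UNIV. f i (x $ i)) has_derivative
      (\<lambda>v. \<Sum>i\<in>UNIV. inner (v $ i) (grad (f i) (x $ i)))) (at x)"
    by (intro has_derivative_sum) blast
  moreover have "(\<lambda>v. \<Sum>i\<in>UNIV. inner (v $ i) (grad (f i) (x $ i))) = (\<lambda>v. inner v (\<chi> i. grad (f i) (x $ i)))"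
    by (rule ext, subst (2) inner_vec_def) (rule sum.cong, simp_all)
  ultimately show "((\<lambda>x. \<Sum>i\<in>UNIV. f i (x $ i)) has_derivative
      (\<lambda>v. inner v (\<chi> i. grad (f i) (x $ i)))) (at x)"
    by (simp only:)
qed

lemma locally_lipschitz_imp_lipschitz_near:
  assumes "locally_lipschitz g"
  shows "lipschitz_near UNIV p g"
proof -
  obtain u L where "u > 0" "L-lipschitz_on (cball p u \<inter> UNIV) g"
    using assms unfolding locally_lipschitz_def local_lipschitz_def
    by (metis Int_UNIV_right UNIV_I centre_in_cball less_imp_le)
  then show ?thesis by (intro lipschitz_nearI[of u L]) (auto elim: lipschitz_on_subset)
qed

section \<open>The saddle-point field\<close>

lemma linear_lap: "linear (lap A :: real^'m^'n \<Rightarrow> real^'m^'n)"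
  by (rule linearI)
     (simp_all add: kron_id_def vec_eq_iff scaleR_right_distrib sum.distrib scaleR_sum_right mult.commute)

lemma lipschitz_near_lap:
  fixes g :: "'a::metric_space \<Rightarrow> real^'m^'n"
  assumes "lipschitz_near UNIV p g"
  shows "lipschitz_near UNIV p (\<lambda>x. lap A (g x))"
  by (rule lipschitz_near_bounded_linear_compose[OF _ assms])
     (use linear_lap linear_conv_bounded_linear in blast)

lemma fs_nce_step_eq_euler:
  "fs_nce_step A f h Gg Gh Kpc Kph T s = s + T *\<^sub>R sp_field A f h Gg Gh Kpc Kph s"
  by (cases s) (simp add: fs_nce_step_def sp_field_def Let_def algebra_simps)

text \<open>An equilibrium is a constant solution, and a constant solution that decays must vanish.\<close>

lemma globally_exp_stable_equilibrium_eq_0: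
  assumes "globally_exp_stable S G \<alpha>" "\<alpha> > 0" "w \<in> S" "G w = 0"
  shows "w = 0"
proof (rule ccontr)
  assume "w \<noteq> 0"
  obtain c where c: "\<And>y t. (\<forall>t\<ge>0. y t \<in> S) \<Longrightarrow> solution G y \<Longrightarrow> t \<ge> 0 \<Longrightarrow>
      norm (y t) \<le> c * exp (- \<alpha> * t) * norm (y 0)"
    using assms(1) unfolding globally_exp_stable_def by meson
  have "solution G (\<lambda>t. w)" by (simp add: solution_def assms(4))
  then have "norm w \<le> c * exp (- \<alpha> * t) * norm w" if "t \<ge> 0" for t
    using c[of "\<lambda>t. w" t] that assms(3) by simp
  then have "\<forall>\<^sub>F t in at_top. 1 \<le> c * exp (- \<alpha> * t)"
    using \<open>w \<noteq> 0\<close> by (intro eventually_at_top_linorderI[of 0]) auto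
  moreover have "((\<lambda>t. c * exp (- \<alpha> * t)) \<longlongrightarrow> c * 0) at_top"
  proof (intro tendsto_intros filterlim_compose[OF exp_at_bot])
    show "LIM t at_top. - \<alpha> * t :> at_bot"
      using assms(2) by (intro filterlim_tendsto_neg_mult_at_bot[OF tendsto_const] filterlim_ident) auto
  qed
  ultimately have "1 \<le> c * 0" by (intro tendsto_lowerbound) auto
  then show False by simp
qed

text \<open>
  The \<open>\<zeta>\<close>-velocity lies in \<open>Im L\<^sub>q\<close> by its form, and the \<open>z\<^sub>c\<close>-velocity lies in \<open>Im L\<close> because \<open>Gc\<close> maps
  \<open>Y\<close> to \<open>Y\<close>; the claim follows since both images are subspaces.
\<close>

lemma admissible_sp_invariant:
  assumes "Gc \<in> Y \<rightarrow> Y" "Y = range (lap A) \<times> UNIV" "block_separable Y Gc Gg Gh"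
    and "s \<in> admissible A"
  shows "s + T *\<^sub>R sp_field A f h Gg Gh Kpc Kph s \<in> admissible A"
proof -
  obtain x \<zeta> zc zh where s: "s = (x, \<zeta>, zc, zh)" by (cases s)
  have sub: "subspace (range (lap A :: real^'m^'n \<Rightarrow> real^'m^'n))" for A :: "real^'n^'n"
    by (intro linear_subspace_image linear_lap subspace_UNIV)
  have "(lap A x, 0) \<in> Y" using assms(2) by simp
  with assms(1,3) have "(col_map Gg (lap A x), col_map Gh 0) \<in> Y"
    unfolding block_separable_def by (metis PiE)
  then have "col_map Gg (lap A x) \<in> range (lap A)" using assms(2) by simp
  then show ?thesis using assms(4)
    by (auto simp: s admissible_def sp_field_def Let_def
        intro!: subspace_add[OF sub] subspace_diff[OF sub] subspace_mul[OF sub])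
qed

text \<open>
  The stationary \<open>z\<close>-equations say that \<open>Gc\<close> vanishes at the output
  \<open>col(L x, h(x) + L\<^sub>q \<zeta>)\<close>, and the origin is the only zero of \<open>Gc\<close> on \<open>Y\<close>.
\<close>

lemma sp_equilibrium_consensus_feasible:
  assumes "globally_exp_stable Y Gc \<alpha>G" "\<alpha>G > 0" "Y = range (lap A) \<times> UNIV"
    and "block_separable Y Gc Gg Gh" and "Kpc \<noteq> 0" "Kph \<noteq> 0"
    and "sp_field A f h Gg Gh Kpc Kph (x, \<zeta>, z) = 0"
  shows "lap A x = 0" and "col_map h x + lap A \<zeta> = 0"
proof -
  obtain zc zh where z: "z = (zc, zh)" by (cases z)
  let ?w = "(lap A x, col_map h x + lap A \<zeta>)"
  have "col_map Gg (lap A x) = 0" "col_map Gh (col_map h x + lap A \<zeta>) = 0"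
    using assms(5-7) by (auto simp: z sp_field_def Let_def zero_prod_def)
  moreover have "?w \<in> Y" using assms(3) by simp
  ultimately have "Gc ?w = 0" using assms(4) by (auto simp: block_separable_def zero_prod_def)
  from globally_exp_stable_equilibrium_eq_0[OF assms(1,2) \<open>?w \<in> Y\<close> this] have "?w = 0" .
  then show "lap A x = 0" "col_map h x + lap A \<zeta> = 0" by (auto simp: zero_prod_def)
qed

text \<open>
  The composition rule for maps that are locally Lipschitz at every point, such as the gradients,
  constraint maps and Jacobians of the single agents.
\<close>

lemma lipschitz_near_compose_everywhere:
  fixes g :: "'a::metric_space \<Rightarrow> 'b::real_normed_vector" and k :: "'b \<Rightarrow> 'c::metric_space"
  assumes "lipschitz_near UNIV p g" "\<And>p. lipschitz_near UNIV p k"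
  shows "lipschitz_near UNIV p (\<lambda>x. k (g x))"
  using lipschitz_near_compose[OF assms(1), of UNIV k] assms(2) by simp

text \<open>
  The output \<open>col(L x, h(x) + L\<^sub>q \<zeta>)\<close> vanishes at the equilibrium, so this bounds the consensus and
  feasibility residuals by a multiple of the distance to the equilibrium.
\<close>

lemma lipschitz_near_residual:
  fixes h :: "'n::finite \<Rightarrow> real^'d \<Rightarrow> real^'q" and p :: "('n, 'd, 'q) state"
  assumes "\<And>i. C2 (h i)"
  shows "lipschitz_near UNIV p (\<lambda>s. (lap A (fst s), col_map h (fst s) + lap A (fst (snd s))))"
proof -
  have "lipschitz_near UNIV p (\<lambda>s. h i (fst s $ i))" for i
    by (rule lipschitz_near_compose_everywhere[where k="h i"])
       (intro lipschitz_near_intros C2_imp_lipschitz_near assms)+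
  then have "lipschitz_near UNIV p (\<lambda>s. col_map h (fst s))"
    by (intro lipschitz_near_vec[where g="\<lambda>s. col_map h (fst s)"]) (simp only: col_map_def vec_lambda_beta)
  then show ?thesis by (intro lipschitz_near_intros lipschitz_near_lap)
qed

text \<open>
  \<open>Gg\<close> and \<open>Gh\<close> are controlled only through \<open>Gc\<close> on \<open>Y\<close>. As the output \<open>w\<close> of every state lies in \<open>Y\<close>,
  the last two components of the field can be rewritten as the components of \<open>Gc (w s)\<close>, and
  smoothness of \<open>Gc\<close> on \<open>Y\<close> suffices for the Lipschitz property on the full state space.
\<close>

lemma lipschitz_near_sp_field:
  fixes h :: "'n::finite \<Rightarrow> real^'d \<Rightarrow> real^'q" and p :: "('n, 'd, 'q) state"
  assumes f: "\<And>i. C2 (f i)" and h: "\<And>i. C2 (h i)"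
    and J: "\<And>i. locally_lipschitz (\<lambda>s. jacobian (h i) (at s))"
    and Y: "Y = range (lap A) \<times> UNIV" and G: "C1_on Y Gc" "block_separable Y Gc Gg Gh"
  shows "lipschitz_near UNIV p (sp_field A f h Gg Gh Kpc Kph)"
proof -
  define w :: "('n, 'd, 'q) state \<Rightarrow> _" where
    "w s = (lap A (fst s), col_map h (fst s) + lap A (fst (snd s)))" for s
  define \<mu> where "\<mu> s = Kph *\<^sub>R snd (w s) + snd (snd (snd s))" for s
  define g where "g s = (\<chi> i. grad (f i) (fst s $ i))" for s :: "('n, 'd, 'q) state"
  define b where "b s = blkdiag_transpose_mult (\<lambda>i. jacobian (h i) (at (fst s $ i))) (\<mu> s)" for s
  have w: "lipschitz_near UNIV p w" unfolding w_def by (rule lipschitz_near_residual[OF h])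
  have wY: "w s \<in> Y" for s using Y by (simp add: w_def)
  have \<mu>: "lipschitz_near UNIV p \<mu>"
    unfolding \<mu>_def by (intro lipschitz_near_intros w)
  have x: "lipschitz_near UNIV p (\<lambda>s :: ('n, 'd, 'q) state. fst s $ i)" for i
    by (intro lipschitz_near_intros)
  have g: "lipschitz_near UNIV p g"
  proof (rule lipschitz_near_vec)
    fix i
    have "lipschitz_near UNIV p (\<lambda>s. grad (f i) (fst s $ i))"
      by (rule lipschitz_near_compose_everywhere[where k="grad (f i)", OF x C2_gradient(2)[OF f]])
    then show "lipschitz_near UNIV p (\<lambda>s. g s $ i)" by (simp add: g_def)
  qed
  have b: "lipschitz_near UNIV p b"
  proof (rule lipschitz_near_vec)
    fix i
    have bil: "bilinear (\<lambda>(M :: real^'d^'q) v. transpose M *v v)"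
      unfolding bilinear_def
      by (auto intro!: linearI simp: transpose_def matrix_vector_mult_def vec_eq_iff
          algebra_simps sum.distrib sum_distrib_left)
    have "lipschitz_near UNIV p (\<lambda>s. jacobian (h i) (at (fst s $ i)))"
      by (rule lipschitz_near_compose_everywhere[where k="\<lambda>v. jacobian (h i) (at v)",
            OF x locally_lipschitz_imp_lipschitz_near[OF J]])
    then have "lipschitz_near UNIV p (\<lambda>s. transpose (jacobian (h i) (at (fst s $ i))) *v (\<mu> s $ i))"
      by (rule lipschitz_near_bilinear[OF _ lipschitz_near_vec_nth[OF \<mu>] bil])
    then show "lipschitz_near UNIV p (\<lambda>s. b s $ i)" by (simp add: b_def blkdiag_transpose_mult_def)
  qed
  have "convex Y" unfolding Y
    by (intro convex_Times subspace_imp_convex linear_subspace_image linear_lap subspace_UNIV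
        convex_UNIV)
  then have Gc: "lipschitz_near UNIV p (\<lambda>s. Gc (w s))"
    using wY by (intro lipschitz_near_compose[where k=Gc, OF w C1_on_imp_lipschitz_near[OF G(1)]]) auto
  have "sp_field A f h Gg Gh Kpc Kph = (\<lambda>s.
      (- g s + (- (Kpc *\<^sub>R lap A (fst s) + fst (snd (snd s))) + - b s),
       - lap A (\<mu> s), - (Kpc *\<^sub>R fst (Gc (w s))), - (Kph *\<^sub>R snd (Gc (w s)))))"
    (is "_ = ?V")
  proof
    fix s
    have "Gc (w s) = (col_map Gg (fst (w s)), col_map Gh (snd (w s)))"
      using G(2) wY[of s] unfolding block_separable_def by (metis prod.collapse)
    then show "sp_field A f h Gg Gh Kpc Kph s = ?V s"
      by (simp add: sp_field_def Let_def case_prod_beta grad_separable_sum[OF f] \<mu>_def w_def b_def g_def)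
  qed
  moreover have "lipschitz_near UNIV p ?V"
    by (intro lipschitz_near_intros lipschitz_near_lap g b Gc \<mu>)
  ultimately show ?thesis by simp
qed

section \<open>Local exponential stability of FS-NCE\<close>

theorem theorem5:
  fixes A :: "real^'n^'n"
    and f :: "'n \<Rightarrow> real^'d \<Rightarrow> real"
    and h :: "'n \<Rightarrow> real^'d \<Rightarrow> real^'q"
    and Gc :: "(real^'d^'n) \<times> (real^'q^'n) \<Rightarrow> (real^'d^'n) \<times> (real^'q^'n)"
    and Gg :: "'n \<Rightarrow> real^'d \<Rightarrow> real^'d"
    and Gh :: "'n \<Rightarrow> real^'q \<Rightarrow> real^'q"
    and Y :: "((real^'d^'n) \<times> (real^'q^'n)) set"
    and sc :: "real^'d" and U :: "(real^'d) set" and xc :: "real^'d^'n"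
    and \<rho>c \<alpha>G \<alpha>SP K0c K0h \<tau>s \<tau> :: real
  assumes "undirected_graph A" and "connected_graph A"
    and "\<And>i. C2 (f i)" and "\<And>i. C2 (h i)"
    and "\<And>i. locally_lipschitz (hessian (f i))"
    and "\<And>i. locally_lipschitz (\<lambda>s. jacobian (h i) (at s))"
    and "sc \<in> feasible h" and "open U" and "sc \<in> U" and "\<rho>c > 0"
    and "local_minimizer_on (objective f) (feasible h \<inter> U) sc"
    and "\<And>s. s \<in> feasible h \<inter> U \<Longrightarrow>
           objective f s \<ge> objective f sc + \<rho>c / 2 * (norm (s - sc))\<^sup>2"
    and "\<And>x :: real^'d^'n. x \<in> ones_kron ` feasible h \<inter> ones_kron ` U \<Longrightarrow>
           rank (\<Sum>i\<in>UNIV. jacobian (h i) (at (x $ i))) = CARD('q)"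
    and "Y = range (lap A) \<times> UNIV"
    and "Gc \<in> Y \<rightarrow> Y" and "C1_on Y Gc" and "Gc 0 = 0"
    and "\<alpha>G > 0" and "globally_exp_stable Y Gc \<alpha>G"
    and "block_separable Y Gc Gg Gh"
    and "K0c > 0" and "K0h > 0"
    and "xc = ones_kron sc"
    and "0 < \<alpha>SP" and "\<alpha>SP < min (\<rho>c / real CARD('n)) \<alpha>G"
    and "sp_threshold A f h Gg Gh K0c K0h xc \<alpha>SP \<tau>s"
    and "0 < \<tau>" and "\<tau> < \<tau>s"
  shows "\<forall>\<alpha>E. 0 < \<alpha>E \<and> \<alpha>E < \<alpha>SP \<longrightarrow>
    (\<exists>Tc>0. \<forall>T. 0 < T \<and> T < Tc \<longrightarrow>
      (let step = fs_nce_step A f h Gg Gh (K0c / \<tau>) (K0h / \<tau>) T in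
       \<exists>\<zeta>s zs. locally_unique (admissible A) (\<lambda>s. step s = s) (xc, \<zeta>s, zs) \<and>
         (\<exists>C>0. \<exists>\<delta>>0. \<forall>x \<zeta> z.
            (\<forall>k. (x (Suc k), \<zeta> (Suc k), z (Suc k)) = step (x k, \<zeta> k, z k)) \<and>
            \<zeta> 0 \<in> range (lap A) \<and> fst (z 0) \<in> range (lap A) \<and>
            norm (x 0 - xc) + norm (\<zeta> 0 - \<zeta>s) + norm (z 0 - zs) < \<delta> \<longrightarrow>
            (\<forall>k. norm (x k - xc) + norm (\<zeta> k - \<zeta>s) + norm (z k - zs)
                   + norm (lap A (x k)) + norm (col_map h (x k) + lap A (\<zeta> k))
                 \<le> C * exp (- \<alpha>E * real k * T)
                   * (norm (x 0 - xc) + norm (\<zeta> 0 - \<zeta>s) + norm (z 0 - zs))))))"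
proof (intro allI impI)
  fix \<alpha>E assume \<alpha>E: "0 < \<alpha>E \<and> \<alpha>E < \<alpha>SP"
  define Kpc Kph where "Kpc = K0c / \<tau>" and "Kph = K0h / \<tau>"
  define V where "V = sp_field A f h Gg Gh Kpc Kph"
  have K: "Kpc \<noteq> 0" "Kph \<noteq> 0" using assms(21,22,27) by (auto simp: Kpc_def Kph_def)
  have "\<exists>\<zeta>s zs. locally_unique (admissible A) (\<lambda>s. V s = 0) (xc, \<zeta>s, zs) \<and>
      (\<exists>C>0. \<exists>\<delta>>0. \<forall>x0 \<zeta>0 z0. (x0, \<zeta>0, z0) \<in> admissible A \<and>
         norm (x0 - xc) + norm (col_map h x0 + lap A \<zeta>0) + norm (z0 - zs) < \<delta> \<longrightarrow>
         (\<exists>y. y 0 = (x0, \<zeta>0, z0) \<and> solution V y) \<and>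
         (\<forall>x \<zeta> z. x 0 = x0 \<and> \<zeta> 0 = \<zeta>0 \<and> z 0 = z0 \<and> solution V (\<lambda>t. (x t, \<zeta> t, z t)) \<longrightarrow>
           (\<forall>t\<ge>0. norm (x t - xc) + norm (\<zeta> t - \<zeta>s) + norm (z t - zs)
                    + norm (lap A (x t)) + norm (col_map h (x t) + lap A (\<zeta> t))
                  \<le> C * exp (- \<alpha>SP * t)
                    * (norm (x0 - xc) + norm (\<zeta>0 - \<zeta>s) + norm (z0 - zs)))))"
    using assms(26)[unfolded sp_threshold_def Let_def, THEN conjunct2, THEN spec, of \<tau>, THEN mp,
        OF conjI[OF assms(27,28)]]
    unfolding V_def Kpc_def Kph_def .
  then obtain \<zeta>s zs C0 \<delta>0 where
    unique: "locally_unique (admissible A) (\<lambda>s. V s = 0) (xc, \<zeta>s, zs)" and "C0 > 0" "\<delta>0 > 0" and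
    stable: "\<forall>x0 \<zeta>0 z0. (x0, \<zeta>0, z0) \<in> admissible A \<and>
        norm (x0 - xc) + norm (col_map h x0 + lap A \<zeta>0) + norm (z0 - zs) < \<delta>0 \<longrightarrow>
        (\<exists>y. y 0 = (x0, \<zeta>0, z0) \<and> solution V y) \<and>
        (\<forall>x \<zeta> z. x 0 = x0 \<and> \<zeta> 0 = \<zeta>0 \<and> z 0 = z0 \<and> solution V (\<lambda>t. (x t, \<zeta> t, z t)) \<longrightarrow>
          (\<forall>t\<ge>0. norm (x t - xc) + norm (\<zeta> t - \<zeta>s) + norm (z t - zs)
                   + norm (lap A (x t)) + norm (col_map h (x t) + lap A (\<zeta> t))
                 \<le> C0 * exp (- \<alpha>SP * t)
                   * (norm (x0 - xc) + norm (\<zeta>0 - \<zeta>s) + norm (z0 - zs))))"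
    by (elim exE conjE) (rule that; assumption)
  define p where "p = (xc, \<zeta>s, zs)"
  have Vp: "V p = 0" using unique by (simp add: locally_unique_def p_def)
  have L0: "lap A xc = 0" and h0: "col_map h xc + lap A \<zeta>s = 0"
    using sp_equilibrium_consensus_feasible[OF assms(19,18,14,20) K] Vp
    unfolding V_def p_def by blast+
  \<comment> \<open>The estimates are phrased with the sum of the three block norms, which is equivalent to the
      norm of the state space.\<close>
  have dist_le: "norm (x - xc) + norm (\<zeta> - \<zeta>s) + norm (z - zs) \<le> 3 * norm ((x, \<zeta>, z) - p)"
    and dist_ge: "norm ((x, \<zeta>, z) - p) \<le> norm (x - xc) + norm (\<zeta> - \<zeta>s) + norm (z - zs)" for x \<zeta> z
  proof -
    have "norm (x - xc) \<le> norm ((x, \<zeta>, z) - p)" "norm ((\<zeta>, z) - (\<zeta>s, zs)) \<le> norm ((x, \<zeta>, z) - p)"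
      using norm_fst_le[of "x - xc" "(\<zeta>, z) - (\<zeta>s, zs)"] norm_snd_le[of "(\<zeta>, z) - (\<zeta>s, zs)" "x - xc"]
      by (simp_all add: p_def)
    moreover have "norm (\<zeta> - \<zeta>s) \<le> norm ((\<zeta>, z) - (\<zeta>s, zs))" "norm (z - zs) \<le> norm ((\<zeta>, z) - (\<zeta>s, zs))"
      using norm_fst_le[of "\<zeta> - \<zeta>s" "z - zs"] norm_snd_le[of "z - zs" "\<zeta> - \<zeta>s"] by simp_all
    ultimately show "norm (x - xc) + norm (\<zeta> - \<zeta>s) + norm (z - zs) \<le> 3 * norm ((x, \<zeta>, z) - p)"
      by linarith
    show "norm ((x, \<zeta>, z) - p) \<le> norm (x - xc) + norm (\<zeta> - \<zeta>s) + norm (z - zs)"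
      using norm_Pair_le[of "x - xc" "(\<zeta> - \<zeta>s, z - zs)"] norm_Pair_le[of "\<zeta> - \<zeta>s" "z - zs"]
      by (simp add: p_def)
  qed
  obtain e1 R where "e1 > 0" "R > 0" and
    R: "R-lipschitz_on (ball p e1 \<inter> UNIV) (\<lambda>s. (lap A (fst s), col_map h (fst s) + lap A (fst (snd s))))"
    by (rule lipschitz_nearE[OF lipschitz_near_residual[OF assms(4)]])
  have residual: "norm (lap A x) \<le> R * norm ((x, \<zeta>, z) - p)"
      "norm (col_map h x + lap A \<zeta>) \<le> R * norm ((x, \<zeta>, z) - p)"
    if "norm ((x, \<zeta>, z) - p) < e1" for x \<zeta> z
  proof -
    have "(x, \<zeta>, z) \<in> ball p e1" using that by (simp add: dist_norm norm_minus_commute)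
    then have "norm (lap A x, col_map h x + lap A \<zeta>) \<le> R * norm ((x, \<zeta>, z) - p)"
      using lipschitz_on_normD[OF R, of "(x, \<zeta>, z)" p] \<open>e1 > 0\<close> by (simp add: p_def L0 h0)
    then show "norm (lap A x) \<le> R * norm ((x, \<zeta>, z) - p)"
        "norm (col_map h x + lap A \<zeta>) \<le> R * norm ((x, \<zeta>, z) - p)"
      using norm_fst_le order_trans norm_snd_le by blast+
  qed
  obtain e K' where "e > 0" and lip: "K'-lipschitz_on (ball p e \<inter> UNIV) V"
    unfolding V_def
    by (rule lipschitz_nearE[OF lipschitz_near_sp_field[OF assms(3,4,6,14,16,20)]])
  \<comment> \<open>The threshold condition measures \<open>\<zeta>\<close> only through \<open>h(x) + L\<^sub>q \<zeta>\<close>; its sum of norms is at most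
      \<open>2 + R\<close> times the distance to \<open>p\<close>.\<close>
  define \<delta>1 where "\<delta>1 = min e1 (\<delta>0 / (2 + R))"
  have "\<delta>1 > 0" using \<open>e1 > 0\<close> \<open>\<delta>0 > 0\<close> \<open>R > 0\<close> by (simp add: \<delta>1_def)
  have flow: "\<exists>y. y 0 = y0 \<and> solution V y \<and>
      (\<forall>t\<ge>0. norm (y t - p) \<le> (3 * C0) * exp (- \<alpha>SP * t) * norm (y0 - p))"
    if y0: "y0 \<in> admissible A" "norm (y0 - p) < \<delta>1" for y0
  proof -
    obtain x0 \<zeta>0 z0 where y0_eq: "y0 = (x0, \<zeta>0, z0)" by (cases y0)
    have "norm (x0 - xc) \<le> norm (y0 - p)" "norm (z0 - zs) \<le> norm (y0 - p)"
      using norm_fst_le[of "x0 - xc" "(\<zeta>0 - \<zeta>s, z0 - zs)"]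
        norm_snd_le[of "(\<zeta>0 - \<zeta>s, z0 - zs)" "x0 - xc"] norm_snd_le[of "z0 - zs" "\<zeta>0 - \<zeta>s"]
      by (auto simp: y0_eq p_def)
    moreover have "norm (col_map h x0 + lap A \<zeta>0) \<le> R * norm (y0 - p)"
      using residual(2)[of x0 \<zeta>0 z0] y0(2) by (simp add: y0_eq \<delta>1_def)
    moreover have "(2 + R) * norm (y0 - p) < \<delta>0"
      using y0(2) \<open>R > 0\<close> by (simp add: \<delta>1_def field_simps)
    ultimately have "norm (x0 - xc) + norm (col_map h x0 + lap A \<zeta>0) + norm (z0 - zs) < \<delta>0"
      by (simp add: algebra_simps)
    note st = stable[THEN spec, THEN spec, THEN spec, THEN mp, OF conjI[OF y0(1)[unfolded y0_eq] this]]
    from st obtain y where y: "y 0 = (x0, \<zeta>0, z0)" "solution V y" by blast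
    have "norm (y t - p) \<le> (3 * C0) * exp (- \<alpha>SP * t) * norm (y0 - p)" if "t \<ge> 0" for t
    proof -
      have sol: "solution V (\<lambda>t. (fst (y t), fst (snd (y t)), snd (snd (y t))))" using y(2) by simp
      have "norm (y t - p) \<le> norm (fst (y t) - xc) + norm (fst (snd (y t)) - \<zeta>s) + norm (snd (snd (y t)) - zs)"
        using dist_ge[of "fst (y t)" "fst (snd (y t))" "snd (snd (y t))"] by simp
      also have "\<dots> \<le> norm (fst (y t) - xc) + norm (fst (snd (y t)) - \<zeta>s) + norm (snd (snd (y t)) - zs)
          + norm (lap A (fst (y t))) + norm (col_map h (fst (y t)) + lap A (fst (snd (y t))))"
        using norm_ge_zero[of "lap A (fst (y t))"]
          norm_ge_zero[of "col_map h (fst (y t)) + lap A (fst (snd (y t)))"] by linarith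
      also have "\<dots> \<le> C0 * exp (- \<alpha>SP * t) * (norm (x0 - xc) + norm (\<zeta>0 - \<zeta>s) + norm (z0 - zs))"
        using st[THEN conjunct2, rule_format, of "\<lambda>t. fst (y t)" "\<lambda>t. fst (snd (y t))" "\<lambda>t. snd (snd (y t))" t]
          sol y(1) that
        by simp
      also have "\<dots> \<le> C0 * exp (- \<alpha>SP * t) * (3 * norm (y0 - p))"
        unfolding y0_eq using \<open>C0 > 0\<close> by (intro mult_left_mono dist_le) auto
      finally show ?thesis by simp
    qed
    with y show ?thesis unfolding y0_eq by blast
  qed
  have lip': "K'-lipschitz_on (ball p e) V" using lip by simp
  have invariant: "s + T *\<^sub>R V s \<in> admissible A" if "s \<in> admissible A" for s T
    unfolding V_def by (rule admissible_sp_invariant[OF assms(15,14,20) that])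
  have "3 * C0 \<ge> 0" using \<open>C0 > 0\<close> by simp
  have "\<exists>T0>0. \<exists>C>0. \<exists>\<delta>>0. \<forall>T s. 0 < T \<and> T < T0 \<and> s 0 \<in> admissible A \<and>
        (\<forall>k. s (Suc k) = s k + T *\<^sub>R V (s k)) \<and> norm (s 0 - p) < \<delta> \<longrightarrow>
        (\<forall>k. norm (s k - p) \<le> C * exp (- \<alpha>E * real k * T) * norm (s 0 - p))"
    by (rule euler_preserves_local_exp_stability[OF \<open>e > 0\<close> lip' Vp _ \<open>\<delta>1 > 0\<close> \<open>3 * C0 \<ge> 0\<close> _
          conjunct1[OF \<alpha>E] conjunct2[OF \<alpha>E]]) (rule invariant flow; assumption)+
  then obtain T0 C \<delta> where T0: "T0 > 0" and "C > 0" and "\<delta> > 0" and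
    decay: "\<forall>T s. 0 < T \<and> T < T0 \<and> s 0 \<in> admissible A \<and>
        (\<forall>k. s (Suc k) = s k + T *\<^sub>R V (s k)) \<and> norm (s 0 - p) < \<delta> \<longrightarrow>
        (\<forall>k. norm (s k - p) \<le> C * exp (- \<alpha>E * real k * T) * norm (s 0 - p))"
    by (elim exE conjE) (rule that; assumption)
  \<comment> \<open>Bounding the iterates by \<open>e1\<close> keeps them where the residual estimates hold; these contribute the
      summand \<open>2 * R\<close> to the final constant.\<close>
  define \<delta>2 where "\<delta>2 = min \<delta> (e1 / C)"
  define C2 where "C2 = (3 + 2 * R) * C"
  have "\<delta>2 > 0" "C2 > 0"
    using \<open>\<delta> > 0\<close> \<open>e1 > 0\<close> \<open>C > 0\<close> \<open>R > 0\<close> by (auto simp: \<delta>2_def C2_def)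
  show "\<exists>Tc>0. \<forall>T. 0 < T \<and> T < Tc \<longrightarrow>
      (let step = fs_nce_step A f h Gg Gh (K0c / \<tau>) (K0h / \<tau>) T in
       \<exists>\<zeta>s zs. locally_unique (admissible A) (\<lambda>s. step s = s) (xc, \<zeta>s, zs) \<and>
         (\<exists>C>0. \<exists>\<delta>>0. \<forall>x \<zeta> z.
            (\<forall>k. (x (Suc k), \<zeta> (Suc k), z (Suc k)) = step (x k, \<zeta> k, z k)) \<and>
            \<zeta> 0 \<in> range (lap A) \<and> fst (z 0) \<in> range (lap A) \<and>
            norm (x 0 - xc) + norm (\<zeta> 0 - \<zeta>s) + norm (z 0 - zs) < \<delta> \<longrightarrow>
            (\<forall>k. norm (x k - xc) + norm (\<zeta> k - \<zeta>s) + norm (z k - zs)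
                   + norm (lap A (x k)) + norm (col_map h (x k) + lap A (\<zeta> k))
                 \<le> C * exp (- \<alpha>E * real k * T)
                   * (norm (x 0 - xc) + norm (\<zeta> 0 - \<zeta>s) + norm (z 0 - zs)))))"
    unfolding Let_def fs_nce_step_eq_euler Kpc_def[symmetric] Kph_def[symmetric] V_def[symmetric]
  proof (rule exI[of _ T0], rule conjI[OF T0], intro allI impI, rule exI[of _ \<zeta>s], rule exI[of _ zs],
      rule conjI)
    fix T assume "0 < T \<and> T < T0"
    then show "locally_unique (admissible A) (\<lambda>s. s + T *\<^sub>R V s = s) (xc, \<zeta>s, zs)"
      using unique by simp
  next
    fix T assume "0 < T \<and> T < T0"
    then have T: "0 < T" "T < T0" by auto
    show "\<exists>C>0. \<exists>\<delta>>0. \<forall>x \<zeta> z.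
        (\<forall>k. (x (Suc k), \<zeta> (Suc k), z (Suc k)) = (x k, \<zeta> k, z k) + T *\<^sub>R V (x k, \<zeta> k, z k)) \<and>
        \<zeta> 0 \<in> range (lap A) \<and> fst (z 0) \<in> range (lap A) \<and>
        norm (x 0 - xc) + norm (\<zeta> 0 - \<zeta>s) + norm (z 0 - zs) < \<delta> \<longrightarrow>
        (\<forall>k. norm (x k - xc) + norm (\<zeta> k - \<zeta>s) + norm (z k - zs)
               + norm (lap A (x k)) + norm (col_map h (x k) + lap A (\<zeta> k))
             \<le> C * exp (- \<alpha>E * real k * T)
               * (norm (x 0 - xc) + norm (\<zeta> 0 - \<zeta>s) + norm (z 0 - zs)))"
    proof (rule exI[of _ C2], rule conjI[OF \<open>C2 > 0\<close>], rule exI[of _ \<delta>2], rule conjI[OF \<open>\<delta>2 > 0\<close>],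
        intro allI impI, elim conjE)
      fix x \<zeta> z k
      assume step: "\<forall>k. (x (Suc k), \<zeta> (Suc k), z (Suc k)) = (x k, \<zeta> k, z k) + T *\<^sub>R V (x k, \<zeta> k, z k)"
        and adm: "\<zeta> 0 \<in> range (lap A)" "fst (z 0) \<in> range (lap A)"
        and init: "norm (x 0 - xc) + norm (\<zeta> 0 - \<zeta>s) + norm (z 0 - zs) < \<delta>2"
      define s where "s k = (x k, \<zeta> k, z k)" for k
      define r where "r = norm (x 0 - xc) + norm (\<zeta> 0 - \<zeta>s) + norm (z 0 - zs)"
      define E where "E = exp (- \<alpha>E * real k * T)"
      have s0: "norm (s 0 - p) \<le> r" unfolding s_def r_def by (rule dist_ge)
      have "E \<le> 1" using \<alpha>E T by (simp add: E_def)
      have "s 0 \<in> admissible A"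
        using adm by (cases "z 0") (simp add: admissible_def s_def)
      moreover have "\<forall>k. s (Suc k) = s k + T *\<^sub>R V (s k)" using step by (simp only: s_def simp_thms)
      moreover have "norm (s 0 - p) < \<delta>" using s0 init by (simp add: r_def \<delta>2_def)
      ultimately have "norm (s k - p) \<le> C * E * norm (s 0 - p)"
        using decay T unfolding E_def by blast
      also have "\<dots> \<le> C * E * r" using s0 \<open>C > 0\<close> by (intro mult_left_mono) (auto simp: E_def)
      finally have sk: "norm (s k - p) \<le> C * E * r" .
      also have "\<dots> \<le> C * 1 * r"
        using \<open>E \<le> 1\<close> \<open>C > 0\<close> by (intro mult_right_mono mult_left_mono) (auto simp: r_def)
      also have "\<dots> < e1" using init \<open>C > 0\<close> by (simp add: r_def \<delta>2_def field_simps)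
      finally have "norm (lap A (x k)) \<le> R * norm (s k - p)"
          "norm (col_map h (x k) + lap A (\<zeta> k)) \<le> R * norm (s k - p)"
        unfolding s_def by (rule residual)+
      then have "norm (x k - xc) + norm (\<zeta> k - \<zeta>s) + norm (z k - zs)
          + norm (lap A (x k)) + norm (col_map h (x k) + lap A (\<zeta> k)) \<le> (3 + 2 * R) * norm (s k - p)"
        using dist_le[of "x k" "\<zeta> k" "z k"] by (simp add: s_def algebra_simps)
      also have "\<dots> \<le> (3 + 2 * R) * (C * E * r)" using sk \<open>R > 0\<close> by (intro mult_left_mono) auto
      finally show "norm (x k - xc) + norm (\<zeta> k - \<zeta>s) + norm (z k - zs)
          + norm (lap A (x k)) + norm (col_map h (x k) + lap A (\<zeta> k))
          \<le> C2 * exp (- \<alpha>E * real k * T) * (norm (x 0 - xc) + norm (\<zeta> 0 - \<zeta>s) + norm (z 0 - zs))"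
        by (simp add: C2_def E_def r_def mult.assoc)
    qed
  qed
qed

end
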